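(* (i) Let $a\ge c\ge 1$ and $b\ge 1$ be integers. The T shape $P(a,b,c,0)$ tiles the plane $\mathbb{Z}^2$ if and only if $b\le 2$, or $c=1$, or ($c=2$ and $b=a+3$). (ii) Let $a,b,c,d\ge 1$ be integers. The cross $P(a,b,c,d)$ tiles the plane $\mathbb{Z}^2$ if and only if two opposite arms have length one (that is, $a=c=1$ or $b=d=1$). In particular, if all four arms have length greater than one, then $P(a,b,c,d)$ does not tile the plane, and indeed is a non-tiler.
   Context: Cells of the square grid are identified with points of $\mathbb{Z}^2$. For natural numbers $a,b,c,d\ge 0$ define $$P(a,b,c,d)=\{(x,0):-c\le x\le a\}\cup\{(0,y):-d\le y\le b\}\subset\mathbb{Z}^2 .$$ A copy of a polyomino is an integer translate of any of its eight images under square-grid rotations and reflections. A polyomino tiles a region $\Omega\subseteq\mathbb{Z}^2$ if there is an arbitrary (not necessarily periodic) collection of copies, each contained in $\Omega$, pairwise disjoint as sets of cells, whose union is $\Omega$. A non-tiler is a polyomino that tiles none of the following: any rectangle $\{0,\dots,u-1\}\times\{0,\dots,v-1\}$, any half-strip $\mathbb{N}\times\{0,\dots,w-1\}$, any bent strip $\{(x,y)\in\mathbb{N}^2:x<u\text{ or }y<v\}$ (with $u,v,w\ge1$ integers), the quadrant $\mathbb{N}^2$, any strip $\mathbb{Z}\times\{0,\dots,w-1\}$, the half-plane $\mathbb{Z}\times\mathbb{N}$, the plane $\mathbb{Z}^2$, or, for any integer $k\ge 2$, the enlargement of itself obtained by replacing each cell $(x,y)$ by the block $\{kx,\dots,kx+k-1\}\times\{ky,\dots,ky+k-1\}$.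 Here $\mathbb{N}=\{0,1,2,\dots\}$. *)

theory Defs
  imports Main
begin

type_synonym cell = "int \<times> int"

definition cross :: "nat \<Rightarrow> nat \<Rightarrow> nat \<Rightarrow> nat \<Rightarrow> cell set" where
  "cross a b c d =
     {(x, 0) | x. - int c \<le> x \<and> x \<le> int a} \<union> {(0, y) | y. - int d \<le> y \<and> y \<le> int b}"

text \<open>The rotations and reflections of the square grid that fix the origin.\<close>

definition grid_symmetries :: "(cell \<Rightarrow> cell) set" where
  "grid_symmetries =
     {\<lambda>(x, y). (x, y), \<lambda>(x, y). (- y, x), \<lambda>(x, y). (- x, - y), \<lambda>(x, y). (y, - x),
      \<lambda>(x, y). (x, - y), \<lambda>(x, y). (- x, y), \<lambda>(x, y). (y, x), \<lambda>(x, y). (- y, - x)}"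

definition is_copy :: "cell set \<Rightarrow> cell set \<Rightarrow> bool" where
  "is_copy P C \<longleftrightarrow>
     (\<exists>g \<in> grid_symmetries. \<exists>s t. C = (\<lambda>(x, y). (x + s, y + t)) ` g ` P)"

definition tiles :: "cell set \<Rightarrow> cell set \<Rightarrow> bool" where
  "tiles P \<Omega> \<longleftrightarrow>
     (\<exists>\<T>. (\<forall>C \<in> \<T>. is_copy P C \<and> C \<subseteq> \<Omega>) \<and> pairwise disjnt \<T> \<and> \<Union>\<T> = \<Omega>)"

definition adjacent :: "cell \<Rightarrow> cell \<Rightarrow> bool" where
  "adjacent p q \<longleftrightarrow> \<bar>fst p - fst q\<bar> + \<bar>snd p - snd q\<bar> = 1"

text \<open>A polyomino is a finite nonempty set of cells that is connected through common edges.\<close>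

definition polyomino :: "cell set \<Rightarrow> bool" where
  "polyomino P \<longleftrightarrow> finite P \<and> P \<noteq> {} \<and>
     (\<forall>p \<in> P. \<forall>q \<in> P. (p, q) \<in> {(r, s). r \<in> P \<and> s \<in> P \<and> adjacent r s}\<^sup>*)"

definition rectangle :: "int \<Rightarrow> int \<Rightarrow> cell set" where
  "rectangle u v = {0..<u} \<times> {0..<v}"

definition half_strip :: "int \<Rightarrow> cell set" where
  "half_strip w = {0..} \<times> {0..<w}"

definition bent_strip :: "int \<Rightarrow> int \<Rightarrow> cell set" where
  "bent_strip u v = {(x, y). 0 \<le> x \<and> 0 \<le> y \<and> (x < u \<or> y < v)}"

definition quadrant :: "cell set" where
  "quadrant = {0..} \<times> {0..}"

definition strip :: "int \<Rightarrow> cell set" where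
  "strip w = UNIV \<times> {0..<w}"

definition half_plane :: "cell set" where
  "half_plane = UNIV \<times> {0..}"

definition plane :: "cell set" where
  "plane = UNIV"

definition enlargement :: "int \<Rightarrow> cell set \<Rightarrow> cell set" where
  "enlargement k P = (\<Union>(x, y) \<in> P. {k * x..k * x + k - 1} \<times> {k * y..k * y + k - 1})"

definition non_tiler :: "cell set \<Rightarrow> bool" where
  "non_tiler P \<longleftrightarrow> polyomino P \<and>
     (\<forall>u \<ge> 1. \<forall>v \<ge> 1. \<not> tiles P (rectangle u v)) \<and>
     (\<forall>w \<ge> 1. \<not> tiles P (half_strip w)) \<and>
     (\<forall>u \<ge> 1. \<forall>v \<ge> 1. \<not> tiles P (bent_strip u v)) \<and>
     \<not> tiles P quadrant \<and>
     (\<forall>w \<ge> 1. \<not> tiles P (strip w)) \<and>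
     \<not> tiles P half_plane \<and>
     \<not> tiles P plane \<and>
     (\<forall>k \<ge> 2. \<not> tiles P (enlargement k P))"

end

theory Submission
  imports Defs
begin

text \<open>A copy of \<open>P(a,b,c,d)\<close> is recorded by its centre and the lengths of its four arms, and a tiling
  of the plane by the predicate \<open>S x y e n w s\<close> of these data.  A cell in a corner, that is, cut off from
  two perpendicular neighbours, is always covered by the end of an arm pointing away from the corner.

  Crosses: let \<open>M\<close> be the longest arm.  On either side of an arm of length \<open>M\<close>, following the forced corner
  cells leads to a parallel arm whose centre lies one or two cells beyond the tip, and the two centres
  must lie at different heights.  Repeating this at the neighbours leaves no room for a longer side arm.

  T shapes: suppose \<open>a, c \<ge> 2\<close> and \<open>b \<ge> 3\<close>.  The two sides of a stem cannot both carry an arm whose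
  cross arm passes over the tip of the stem, so some bar lies flat against the side of a stem and encloses
  a pocket with its own stem.  Filling this pocket forces the shorter arm of the bar to be \<open>2\<close>
  and \<open>b > a + c\<close>, and turns the stem of that bar into the floor of a trough of width \<open>b\<close>, which can only
  be filled by a single flat bar; hence \<open>b = a + c + 1\<close>, which is \<open>a + 3\<close> when \<open>c = 2\<close>.

  The remaining shapes tile periodically.\<close>

section \<open>Placed tiles\<close>

text \<open>Every arm of a cross is positive, so tiles in neighbouring columns obstruct each other
  by their side arms, and following one longest arm is enough. A T has a flat side, and two bars may
  stand back to back; hence the detour through enclosed cells.

  The exceptional family has to enter somewhere. A pocket gives an arm of length \<open>2\<close>
  and \<open>b > a + c\<close>; excluding \<open>b = a + c + 1\<close> at this point leaves
  \<open>b \<ge> a + c + 2\<close>, which no longer fits the one width above three that a trough can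
  have.

  The regions with a corner or a straight edge are elementary: a corner cell cannot be covered by a
  tile with four positive arms, and two neighbouring cells on an edge cannot both be. In an
  enlargement the longest arm \<open>M\<close> is magnified to at least \<open>2 * M\<close>, so the
  tile over an outer corner cell at its end cannot have its centre near the middle, and nowhere else
  is there room for one.

  Apart from the tiling by four copies, the periodic tilings come from residues, combined with the
  parity of a row or column where needed: the cells of one or two tiles represent every class
  exactly once.\<close>

definition cells :: "int \<Rightarrow> int \<Rightarrow> int \<Rightarrow> int \<Rightarrow> int \<Rightarrow> int \<Rightarrow> cell set" where
  "cells x y e n w s = {x - w..x + e} \<times> {y} \<union> {x} \<times> {y - s..y + n}"

lemma mem_cells [simp]:
  "(p, q) \<in> cells x y e n w s \<longleftrightarrow>
     q = y \<and> x - w \<le> p \<and> p \<le> x + e \<or> p = x \<and> y - s \<le> q \<and> q \<le> y + n"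
  by (auto simp: cells_def)

text \<open>The alternatives are the orbit of the four lengths under the dihedral group: first the
  cyclic rotations, then the reflections.\<close>

definition arms :: "int \<Rightarrow> int \<Rightarrow> int \<Rightarrow> int \<Rightarrow> int \<Rightarrow> int \<Rightarrow> int \<Rightarrow> int \<Rightarrow> bool" where
  "arms a b c d e n w s \<longleftrightarrow>
     (e = a \<and> n = b \<and> w = c \<and> s = d) \<or>
     (e = d \<and> n = a \<and> w = b \<and> s = c) \<or>
     (e = c \<and> n = d \<and> w = a \<and> s = b) \<or>
     (e = b \<and> n = c \<and> w = d \<and> s = a) \<or>
     (e = a \<and> n = d \<and> w = c \<and> s = b) \<or>
     (e = c \<and> n = b \<and> w = a \<and> s = d) \<or>
     (e = b \<and> n = a \<and> w = d \<and> s = c) \<or>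
     (e = d \<and> n = c \<and> w = b \<and> s = a)"

lemma mem_cross: "(p, q) \<in> cross a b c d \<longleftrightarrow> (p, q) \<in> cells 0 0 (int a) (int b) (int c) (int d)"
  by (auto simp: cross_def)

lemma image_symmetry:
  fixes A :: "cell set"
  shows "(\<lambda>(x, y). (x, y)) ` A = {(p, q). (p, q) \<in> A}"
    "(\<lambda>(x, y). (- y, x)) ` A = {(p, q). (q, - p) \<in> A}"
    "(\<lambda>(x, y). (- x, - y)) ` A = {(p, q). (- p, - q) \<in> A}"
    "(\<lambda>(x, y). (y, - x)) ` A = {(p, q). (- q, p) \<in> A}"
    "(\<lambda>(x, y). (x, - y)) ` A = {(p, q). (p, - q) \<in> A}"
    "(\<lambda>(x, y). (- x, y)) ` A = {(p, q). (- p, q) \<in> A}"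
    "(\<lambda>(x, y). (y, x)) ` A = {(p, q). (q, p) \<in> A}"
    "(\<lambda>(x, y). (- y, - x)) ` A = {(p, q). (- q, - p) \<in> A}"
    "(\<lambda>(x, y). (x + s, y + t)) ` A = {(p, q). (p - s, q - t) \<in> A}"
  by (force simp: image_iff)+

lemma image_cross:
  "(\<lambda>(x, y). (x, y)) ` cross a b c d = cells 0 0 (int a) (int b) (int c) (int d)"
  "(\<lambda>(x, y). (- y, x)) ` cross a b c d = cells 0 0 (int d) (int a) (int b) (int c)"
  "(\<lambda>(x, y). (- x, - y)) ` cross a b c d = cells 0 0 (int c) (int d) (int a) (int b)"
  "(\<lambda>(x, y). (y, - x)) ` cross a b c d = cells 0 0 (int b) (int c) (int d) (int a)"
  "(\<lambda>(x, y). (x, - y)) ` cross a b c d = cells 0 0 (int a) (int d) (int c) (int b)"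
  "(\<lambda>(x, y). (- x, y)) ` cross a b c d = cells 0 0 (int c) (int b) (int a) (int d)"
  "(\<lambda>(x, y). (y, x)) ` cross a b c d = cells 0 0 (int b) (int a) (int d) (int c)"
  "(\<lambda>(x, y). (- y, - x)) ` cross a b c d = cells 0 0 (int d) (int c) (int b) (int a)"
  unfolding image_symmetry by (auto simp: mem_cross)

lemma image_shift_cells: "(\<lambda>(x, y). (x + s, y + t)) ` cells 0 0 e n w w' = cells s t e n w w'"
  unfolding image_symmetry by auto

lemma is_copy_iff:
  "is_copy (cross a b c d) C \<longleftrightarrow>
     (\<exists>x y e n w s. arms (int a) (int b) (int c) (int d) e n w s \<and> C = cells x y e n w s)"
  unfolding is_copy_def grid_symmetries_def arms_def
  by (auto simp only: bex_simps image_cross image_shift_cells insert_iff prod.inject empty_iff)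
    (intro exI, rule conjI[OF _ refl], simp)+

text \<open>Recording that an edge is not crossed, and not which tile lies beside it, lets a floor
  or wall be composed of several tiles and be carried through changes of coordinates.\<close>

definition joined ::
    "(int \<Rightarrow> int \<Rightarrow> int \<Rightarrow> int \<Rightarrow> int \<Rightarrow> int \<Rightarrow> bool) \<Rightarrow> int \<Rightarrow> int \<Rightarrow> int \<Rightarrow> int \<Rightarrow> bool" where
  "joined S p q p' q' \<longleftrightarrow>
     (\<exists>x y e n w s. S x y e n w s \<and> (p, q) \<in> cells x y e n w s \<and> (p', q') \<in> cells x y e n w s)"

text \<open>\<open>S x y e n w s\<close>: there is a tile with centre \<open>(x, y)\<close> and arms of lengths \<open>e\<close>, \<open>n\<close>, \<open>w\<close>, \<open>s\<close>
  to the right, up, to the left and down.\<close>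

locale plane_tiling =
  fixes S :: "int \<Rightarrow> int \<Rightarrow> int \<Rightarrow> int \<Rightarrow> int \<Rightarrow> int \<Rightarrow> bool"
  assumes nonneg: "S x y e n w s \<Longrightarrow> 0 \<le> e \<and> 0 \<le> n \<and> 0 \<le> w \<and> 0 \<le> s"
    and cover: "\<exists>x y e n w s. S x y e n w s \<and> (p, q) \<in> cells x y e n w s"
    and unique: "S x y e n w s \<Longrightarrow> S x' y' e' n' w' s' \<Longrightarrow> (p, q) \<in> cells x y e n w s \<Longrightarrow>
      (p, q) \<in> cells x' y' e' n' w' s' \<Longrightarrow> x = x' \<and> y = y' \<and> e = e' \<and> n = n' \<and> w = w' \<and> s = s'"
begin

lemma covered:
  obtains x y e n w s where "S x y e n w s" "(p, q) \<in> cells x y e n w s"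
  using cover[of p q] by (elim exE conjE)

lemma shift: "plane_tiling (\<lambda>x y. S (x + p) (y + q))"
proof (unfold_locales, goal_cases)
  case 1
  then show ?case by (rule nonneg)
next
  case (2 u v)
  obtain x y e n w s where "S x y e n w s" "(u + p, v + q) \<in> cells x y e n w s"
    by (rule covered)
  then show ?case
    by - (rule exI[of _ "x - p"], rule exI[of _ "y - q"], rule exI[of _ e], rule exI[of _ n], rule exI[of _ w], rule exI[of _ s], auto)
next
  case (3 x y e n w s x' y' e' n' w' s' u v)
  have "x + p = x' + p \<and> y + q = y' + q \<and> e = e' \<and> n = n' \<and> w = w' \<and> s = s'"
    by (rule unique[OF 3(1,2), of "u + p" "v + q"]) (use 3(3,4) in auto)
  then show ?case by simp
qed

lemma mirror: "plane_tiling (\<lambda>x y e n w s. S (- x) y w n e s)"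
proof (unfold_locales, goal_cases)
  case 1
  from nonneg[OF 1] show ?case by simp
next
  case (2 u v)
  obtain x y e n w s where "S x y e n w s" "(- u, v) \<in> cells x y e n w s"
    by (rule covered)
  then show ?case
    by - (rule exI[of _ "- x"], rule exI[of _ y], rule exI[of _ w], rule exI[of _ n], rule exI[of _ e], rule exI[of _ s], auto)
next
  case (3 x y e n w s x' y' e' n' w' s' u v)
  have "- x = - x' \<and> y = y' \<and> w = w' \<and> n = n' \<and> e = e' \<and> s = s'"
    by (rule unique[OF 3(1,2), of "- u" v]) (use 3(3,4) in auto)
  then show ?case by simp
qed

lemma transpose: "plane_tiling (\<lambda>x y e n w s. S y x n e s w)"
proof (unfold_locales, goal_cases)
  case 1
  from nonneg[OF 1] show ?case by simp
next
  case (2 u v)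
  obtain x y e n w s where "S x y e n w s" "(v, u) \<in> cells x y e n w s"
    by (rule covered)
  then show ?case
    by - (rule exI[of _ y], rule exI[of _ x], rule exI[of _ n], rule exI[of _ e], rule exI[of _ s], rule exI[of _ w], auto)
next
  case (3 x y e n w s x' y' e' n' w' s' u v)
  have "y = y' \<and> x = x' \<and> n = n' \<and> e = e' \<and> s = s' \<and> w = w'"
    by (rule unique[OF 3(1,2), of v u]) (use 3(3,4) in auto)
  then show ?case by simp
qed

text \<open>Disjointness becomes a set of linear inequalities: bars on one line are tested at the
  larger of their left or lower ends, perpendicular bars at the cell where their lines
  cross.\<close>

lemma apart:
  assumes "S x y e n w s" "S x' y' e' n' w' s'" "x \<noteq> x' \<or> y \<noteq> y'"
  shows "(y = y' \<longrightarrow> x + e < x' - w' \<or> x' + e' < x - w) \<and>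
    (x = x' \<longrightarrow> y + n < y' - s' \<or> y' + n' < y - s) \<and>
    (x < x' - w' \<or> x' + e' < x \<or> y' < y - s \<or> y + n < y') \<and>
    (x' < x - w \<or> x + e < x' \<or> y < y' - s' \<or> y' + n' < y)"
proof -
  have disj: "\<not> ((p, q) \<in> cells x y e n w s \<and> (p, q) \<in> cells x' y' e' n' w' s')" for p q
    using unique[OF assms(1,2)] assms(3) by metis
  note nn = nonneg[OF assms(1)] nonneg[OF assms(2)]
  show ?thesis
    using nn disj[of "max (x - w) (x' - w')" y] disj[of x "max (y - s) (y' - s')"]
      disj[of x y'] disj[of x' y]
    unfolding mem_cells by (smt (verit))
qed

lemma joinedI:
  "S x y e n w s \<Longrightarrow> (p, q) \<in> cells x y e n w s \<Longrightarrow> (p', q') \<in> cells x y e n w s \<Longrightarrow> joined S p q p' q'"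
  unfolding joined_def by blast

lemma not_joined:
  assumes "S x y e n w s" "(p, q) \<in> cells x y e n w s" "(p', q') \<notin> cells x y e n w s"
  shows "\<not> joined S p q p' q'" "\<not> joined S p' q' p q"
  using assms unique unfolding joined_def by metis+

text \<open>A cell that is cut off from its left and lower neighbours and is not the end of an arm
  would have to be a centre with neither a left nor a lower arm.\<close>

lemma corner:
  assumes no_L: "\<And>x y e n w s. S x y e n w s \<Longrightarrow> 0 < w \<or> 0 < s"
    and cut: "\<not> joined S (p - 1) q p q" "\<not> joined S p (q - 1) p q"
  obtains (up) k e n w where "1 \<le> k" "S p (q + k) e n w k"
    | (right) k e n s where "1 \<le> k" "S (p + k) q e n k s"
proof -
  obtain x y e n w s where t: "S x y e n w s" "(p, q) \<in> cells x y e n w s"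
    by (rule covered)
  then have "(p - 1, q) \<notin> cells x y e n w s" "(p, q - 1) \<notin> cells x y e n w s"
    using cut unfolding joined_def by blast+
  with t(2) nonneg[OF t(1)] no_L[OF t(1)]
  consider "p = x" "y = q + s" "1 \<le> s" | "q = y" "x = p + w" "1 \<le> w"
    unfolding mem_cells by (smt (verit))
  then show thesis
    using t(1) up right by cases blast+
qed

lemma lower_corner:
  assumes no_L: "\<And>x y e n w s. S x y e n w s \<Longrightarrow> 0 < w \<or> 0 < n"
    and cut: "\<not> joined S (p - 1) q p q" "\<not> joined S p (q + 1) p q"
  obtains (down) k e w s where "1 \<le> k" "S p (q - k) e k w s"
    | (right) k e n s where "1 \<le> k" "S (p + k) q e n k s"
proof -
  obtain x y e n w s where t: "S x y e n w s" "(p, q) \<in> cells x y e n w s"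
    by (rule covered)
  then have "(p - 1, q) \<notin> cells x y e n w s" "(p, q + 1) \<notin> cells x y e n w s"
    using cut unfolding joined_def by blast+
  with t(2) nonneg[OF t(1)] no_L[OF t(1)]
  consider "p = x" "y = q - n" "1 \<le> n" | "q = y" "x = p + w" "1 \<le> w"
    unfolding mem_cells by (smt (verit))
  then show thesis
    using t(1) down right by cases blast+
qed

end

section \<open>Crosses with two long perpendicular arms\<close>

text \<open>The last two conjuncts say that neither pair of opposite arms consists of two arms of
  length one. Here \<open>M\<close> is only an upper bound; an arm attaining it enters through the
  tile \<open>O\<close> of the lemmas below.\<close>

locale cross_tiling = plane_tiling +
  fixes M :: int
  assumes bounds: "S x y e n w s \<Longrightarrow> 1 \<le> e \<and> e \<le> M \<and> 1 \<le> n \<and> n \<le> M \<and> 1 \<le> w \<and> w \<le> M \<and> 1 \<le> s \<and> s \<le> M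
      \<and> (2 \<le> e \<or> 2 \<le> w) \<and> (2 \<le> n \<or> 2 \<le> s)"
begin

lemma M_ge: "S x y e n w s \<Longrightarrow> 2 \<le> M"
  by (drule bounds) linarith

lemma cross_corner:
  assumes cut: "\<not> joined S (p - 1) q p q" "\<not> joined S p (q - 1) p q"
  obtains (up) k e n w where "1 \<le> k" "S p (q + k) e n w k"
    | (right) k e n s where "1 \<le> k" "S (p + k) q e n k s"
proof (rule corner[OF _ cut])
  show "0 < w \<or> 0 < s" if "S x y e n w s" for x y e n w s
    using bounds[OF that] by simp
qed (use that in blast)+

lemma cross_lower_corner:
  assumes cut: "\<not> joined S (p - 1) q p q" "\<not> joined S p (q + 1) p q"
  obtains (down) k e w s where "1 \<le> k" "S p (q - k) e k w s"
    | (right) k e n s where "1 \<le> k" "S (p + k) q e n k s"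
proof (rule lower_corner[OF _ cut])
  show "0 < w \<or> 0 < n" if "S x y e n w s" for x y e n w s
    using bounds[OF that] by simp
qed (use that in blast)+

lemma cross_shift: "cross_tiling (\<lambda>x y. S (x + p) (y + q)) M"
  by (intro cross_tiling.intro shift cross_tiling_axioms.intro) (drule bounds, auto)

lemma cross_mirror: "cross_tiling (\<lambda>x y e n w s. S (- x) y w n e s) M"
  by (intro cross_tiling.intro mirror cross_tiling_axioms.intro) (drule bounds, auto)

lemma cross_transpose: "cross_tiling (\<lambda>x y e n w s. S y x n e s w) M"
  by (intro cross_tiling.intro transpose cross_tiling_axioms.intro) (drule bounds, auto)

lemma cross_turn: "cross_tiling (\<lambda>x y e n w s. S (- x) (- y) w s e n) M"
  using cross_tiling.cross_mirror[OF cross_tiling.cross_transpose[OF cross_tiling.cross_mirror[OF cross_transpose]]] .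

text \<open>A vertical arm ending at \<open>(1, 1)\<close> or \<open>(1, 2)\<close> has its centre
  in column 1, and the left arm there must pass above the tip \<open>(0, M)\<close>; since no arm
  exceeds \<open>M\<close>, only the listed heights remain. Horizontal arms cannot end at both
  cells, as a vertical arm of one tile would hit the other. In the case \<open>low\<close>,
  \<open>e \<le> L\<close> because the lower arm at column \<open>1 + L\<close> must clear the right
  arm of \<open>O\<close>.\<close>

lemma beside_arm:
  assumes O: "S 0 0 e M w s"
  obtains (direct) e' n' w' where "S 1 (M + 1) e' n' w' M"
    | (low) e' n' w' L e1 n1 s1 where "S 1 (M + 1) e' n' w' (M - 1)" "S (1 + L) 1 e1 n1 L s1" "e \<le> L"
    | (high) e' n' w' where "S 1 (M + 2) e' n' w' M"
proof -
  note M = M_ge[OF O] and bO = bounds[OF O]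
  have "\<not> joined S (1 - 1) 1 1 1" "\<not> joined S 1 (1 - 1) 1 1"
    by (rule not_joined(1)[OF O]; use bO in simp)+
  then consider (up) k e' n' w' where "1 \<le> k" "S 1 (1 + k) e' n' w' k"
    | (right) L e1 n1 s1 where "1 \<le> L" "S (1 + L) 1 e1 n1 L s1"
    by (rule cross_corner)
  then show thesis
  proof cases
    case up
    then have "k = M"
      using bounds[OF up(2)] apart[OF O up(2)] M bO by (smt (verit))
    then show thesis
      using direct up by (simp add: add.commute)
  next
    case right
    note D = right(2)
    have L: "e \<le> L"
      using bounds[OF D] apart[OF O D] bO by (smt (verit))
    have "\<not> joined S (1 - 1) 2 1 2"
      by (rule not_joined(1)[OF O]; use bO M in simp)
    moreover have "\<not> joined S 1 (2 - 1) 1 2"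
      by (rule not_joined(1)[OF D]; use right(1) bounds[OF D] in simp)
    ultimately show thesis
    proof (cases rule: cross_corner)
      case (up k e' n' w')
      have "k = M \<or> k = M - 1"
        using bounds[OF up(2)] apart[OF O up(2)] M bO by (smt (verit))
      with up(2) show thesis
        using low[OF _ D L] high by (auto simp: add.commute)
    next
      case r: (right L' e2 n2 s2)
      then show thesis
        using bounds[OF D] bounds[OF r(2)] apart[OF D r(2)] by (smt (verit))
    qed
  qed
qed

lemma turn_at: "cross_tiling (\<lambda>x y e n w s. S (p - x) (q - y) w s e n) M"
  using cross_tiling.cross_turn[OF cross_shift[of p q]] by simp

text \<open>Centres at equal height in columns -1 and 1 would both cover the cell between them. At
  different heights each inner arm is stopped by the vertical bar of the other tile, hence has
  length one.\<close>

lemma above_arm: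
  assumes O: "S 0 0 e M w s"
  obtains (left) nA wA eB nB kB where "S (- 1) (M + 2) 1 nA wA M" "S 1 (M + 1) eB nB 1 kB"
      "kB = M \<or> kB = M - 1 \<and> (\<exists>L e1 n1 s1. e \<le> L \<and> S (1 + L) 1 e1 n1 L s1)"
    | (right) nA eA wB nB kB where "S 1 (M + 2) eA nA 1 M" "S (- 1) (M + 1) 1 nB wB kB" "M - 1 \<le> kB"
proof -
  interpret m: cross_tiling "\<lambda>x y e n w s. S (- x) y w n e s" M by (rule cross_mirror)
  have O': "S (- 0) 0 e M w s" using O by simp
  note M = M_ge[OF O]
  have R: "(\<exists>e' n' w' k. S 1 (M + 1) e' n' w' k \<and>
      (k = M \<or> k = M - 1 \<and> (\<exists>L e1 n1 s1. e \<le> L \<and> S (1 + L) 1 e1 n1 L s1))) \<or>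
    (\<exists>e' n' w'. S 1 (M + 2) e' n' w' M)"
    using beside_arm[OF O] by metis
  have L: "(\<exists>e' n' w' k. S (- 1) (M + 1) e' n' w' k \<and> M - 1 \<le> k) \<or>
    (\<exists>e' n' w'. S (- 1) (M + 2) e' n' w' M)"
    by (rule m.beside_arm[OF O']) (fastforce+)
  from R consider
      (B) e1 n1 w1 k where "S 1 (M + 1) e1 n1 w1 k"
        "k = M \<or> k = M - 1 \<and> (\<exists>L e1 n1 s1. e \<le> L \<and> S (1 + L) 1 e1 n1 L s1)"
    | (A) e1 n1 w1 where "S 1 (M + 2) e1 n1 w1 M"
    by blast
  then show thesis
  proof cases
    case B
    from L consider (B') e' n' w' k' where "S (- 1) (M + 1) e' n' w' k'"
      | (A') e' n' w' where "S (- 1) (M + 2) e' n' w' M"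
      by blast
    then show thesis
    proof cases
      case B'
      show thesis using apart[OF B(1) B'] bounds[OF B(1)] bounds[OF B'] by (smt (verit))
    next
      case A'
      have "e' = 1" "w1 = 1"
        using apart[OF B(1) A'] bounds[OF B(1)] bounds[OF A'] by (smt (verit))+
      with A' B left show thesis by blast
    qed
  next
    case A
    from L consider (B') e' n' w' k' where "S (- 1) (M + 1) e' n' w' k'" "M - 1 \<le> k'"
      | (A') e' n' w' where "S (- 1) (M + 2) e' n' w' M"
      by blast
    then show thesis
    proof cases
      case B'
      have "e' = 1" "w1 = 1"
        using apart[OF B'(1) A] bounds[OF B'(1)] bounds[OF A] by (smt (verit))+
      with A B' right show thesis by blast
    next
      case A'
      show thesis using apart[OF A A'] bounds[OF A] bounds[OF A'] by (smt (verit))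
    qed
  qed
qed

lemma no_left_above:
  assumes O: "S 0 0 e M w s" and A: "S (- 1) (M + 2) 1 nA wA M" and B: "S 1 (M + 1) eB nB 1 kB"
    and kB: "kB = M \<or> kB = M - 1 \<and> (\<exists>L e1 n1 s1. e \<le> L \<and> S (1 + L) 1 e1 n1 L s1)"
  shows False
proof -
  note M = M_ge[OF O] and bO = bounds[OF O]
  \<comment> \<open>The lower arm of A has length \<open>M\<close> too. After a half turn about the
    centre of A, the tile \<open>O\<close> appears in the role of the higher neighbour, whose inner
    arm has length one; the other alternative puts a centre at \<open>(0, 1)\<close>, inside the
    upper arm of \<open>O\<close>.\<close>
  have "w = 1"
  proof -
    interpret t: cross_tiling "\<lambda>x y e n w s. S (- 1 - x) (M + 2 - y) w s e n" M by (rule turn_at)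
    have A': "S (- 1 - 0) (M + 2 - 0) 1 nA wA M" using A by simp
    show ?thesis
    proof (rule t.above_arm[OF A'])
      fix nA' wA' assume "S (- 1 - (- 1)) (M + 2 - (M + 2)) wA' M 1 nA'"
      then show ?thesis using unique[OF O, of 0 0 wA' M 1 nA' 0 0] bounds[OF O] by (auto dest: bounds)
    next
      fix nB' wB' kB' assume B': "S (- 1 - - 1) (M + 2 - (M + 1)) wB' kB' 1 nB'" and "M - 1 \<le> kB'"
      then show ?thesis using apart[OF O B'] bounds[OF B'] bO by (smt (verit))
    qed
  qed
  then have e: "2 \<le> e" using bO by auto
  \<comment> \<open>The same half turn about B would give either a centre \<open>(2, -1)\<close>
    with an arm of length \<open>M\<close> up through \<open>(2, 0)\<close>, a cell of the right arm
    of \<open>O\<close> since \<open>2 \<le> e\<close>, or a centre \<open>(0, -1)\<close> in the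
    lower arm of \<open>O\<close>.\<close>
  have "kB \<noteq> M"
  proof
    assume "kB = M"
    interpret t: cross_tiling "\<lambda>x y e n w s. S (1 - x) (M + 1 - y) w s e n" M by (rule turn_at)
    have B': "S (1 - 0) (M + 1 - 0) eB nB 1 M" using B \<open>kB = M\<close> by simp
    show False
    proof (rule t.above_arm[OF B'])
      fix nA' wA' assume C: "S (1 - (- 1)) (M + 1 - (M + 2)) wA' M 1 nA'"
      then show ?thesis using apart[OF O C] bounds[OF C] bO e by (smt (verit))
    next
      fix nA' eA' assume C: "S (1 - 1) (M + 1 - (M + 2)) 1 M eA' nA'"
      then show ?thesis using apart[OF O C] bounds[OF C] bO by (smt (verit))
    qed
  qed
  then obtain L e1 n1 s1 where "kB = M - 1" and L: "2 \<le> L" and D: "S (1 + L) 1 e1 n1 L s1"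
    using kB e by (metis order_trans)
  with B have B: "S 1 (M + 1) eB nB 1 (M - 1)" by simp
  note bB = bounds[OF B] and bD = bounds[OF D]
  \<comment> \<open>Right of B, the rows from 2 to \<open>M\<close> lie between the arm of D in row
    1 and the right arm of B. A vertical arm with its upper end here has its centre here as well,
    and then its left arm hits B, or it crosses D.\<close>
  have down: False if "1 \<le> k" "S 2 (q - k) e' k w' s'" "q \<le> M" "1 \<le> q" for q k e' w' s'
    using apart[OF B that(2)] apart[OF D that(2)] bounds[OF that(2)] bB bD L that
    by (smt (verit))
  have "\<not> joined S (2 - 1) M 2 M" "\<not> joined S 2 (M + 1) 2 M"
    by (rule not_joined(1)[OF B]; use bB M in simp)+
  then obtain N eE nE sE where N: "1 \<le> N" and E: "S (2 + N) M eE nE N sE"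
    by (rule cross_lower_corner) (use down[of _ M] M in force)+
  note bE = bounds[OF E]
  \<comment> \<open>For \<open>M = 2\<close> the arm of E would lie directly on that of D, and a
    vertical arm of one tile would meet the other. The same collision, between E and F, ends the
    proof.\<close>
  have M3: "3 \<le> M"
    using apart[OF D E] bD bE L N by (smt (verit))
  have "\<not> joined S (2 - 1) (M - 1) 2 (M - 1)"
    by (rule not_joined(1)[OF B]; use bB M3 in simp)
  moreover have "\<not> joined S 2 (M - 1 + 1) 2 (M - 1)"
    by (rule not_joined(1)[OF E]; use bE N in simp)
  ultimately obtain N' eF nF sF where "1 \<le> N'" and F: "S (2 + N') (M - 1) eF nF N' sF"
    by (rule cross_lower_corner) (use down[of _ "M - 1"] M3 in force)+
  then show False
    using apart[OF E F] bE bounds[OF F] N by auto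
qed

text \<open>The alternative \<open>right\<close> of \<open>above_arm\<close> says nothing about an
  arm L, so the mirror image is analysed afresh. It either falls under \<open>no_left_above\<close>
  or puts two centres directly above each other in column -1.\<close>

lemma no_long_arm:
  assumes O: "S 0 0 e M w s"
  shows False
proof (rule above_arm[OF O])
  show False if "S (- 1) (M + 2) 1 nA wA M" "S 1 (M + 1) eB nB 1 kB"
    "kB = M \<or> kB = M - 1 \<and> (\<exists>L e1 n1 s1. e \<le> L \<and> S (1 + L) 1 e1 n1 L s1)" for nA wA eB nB kB
    using no_left_above[OF O that] .
next
  fix nA eA wB nB kB
  assume A: "S 1 (M + 2) eA nA 1 M" and B: "S (- 1) (M + 1) 1 nB wB kB"
  interpret m: cross_tiling "\<lambda>x y e n w s. S (- x) y w n e s" M by (rule cross_mirror)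
  have O': "S (- 0) 0 e M w s" using O by simp
  show False
  proof (rule m.above_arm[OF O'])
    fix nA wA eB nB kB
    assume "S (- (- 1)) (M + 2) wA nA 1 M" "S (- 1) (M + 1) 1 nB eB kB"
      "kB = M \<or> kB = M - 1 \<and> (\<exists>L e1 n1 s1. w \<le> L \<and> S (- (1 + L)) 1 L n1 e1 s1)"
    then show False using m.no_left_above[OF O'] by blast
  next
    fix nA' eA' wB' nB' kB' assume C: "S (- 1) (M + 2) 1 nA' eA' M"
    show False using apart[OF B C] bounds[OF B] bounds[OF C] by auto
  qed
qed

end

section \<open>T shapes with a long stem and long arms\<close>

lemma joined_shift: "joined (\<lambda>x y. S (x + u) (y + v)) p q p' q' \<longleftrightarrow> joined S (p + u) (q + v) (p' + u) (q' + v)"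
proof
  assume "joined (\<lambda>x y. S (x + u) (y + v)) p q p' q'"
  then obtain x y e n w s where "S (x + u) (y + v) e n w s"
    "(p, q) \<in> cells x y e n w s" "(p', q') \<in> cells x y e n w s"
    unfolding joined_def by blast
  then have "S (x + u) (y + v) e n w s" "(p + u, q + v) \<in> cells (x + u) (y + v) e n w s"
    "(p' + u, q' + v) \<in> cells (x + u) (y + v) e n w s" by auto
  then show "joined S (p + u) (q + v) (p' + u) (q' + v)"
    unfolding joined_def by blast
next
  assume "joined S (p + u) (q + v) (p' + u) (q' + v)"
  then obtain x y e n w s where "S x y e n w s"
    "(p + u, q + v) \<in> cells x y e n w s" "(p' + u, q' + v) \<in> cells x y e n w s"
    unfolding joined_def by blast
  then have "S (x - u + u) (y - v + v) e n w s" "(p, q) \<in> cells (x - u) (y - v) e n w s"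
    "(p', q') \<in> cells (x - u) (y - v) e n w s" by auto
  then show "joined (\<lambda>x y. S (x + u) (y + v)) p q p' q'"
    unfolding joined_def by blast
qed

lemma joined_mirror:
  "joined (\<lambda>x y e n w s. S (- x) y w n e s) p q p' q' \<longleftrightarrow> joined S (- p) q (- p') q'"
proof
  assume "joined (\<lambda>x y e n w s. S (- x) y w n e s) p q p' q'"
  then obtain x y e n w s where "S (- x) y w n e s"
    "(p, q) \<in> cells x y e n w s" "(p', q') \<in> cells x y e n w s"
    unfolding joined_def by blast
  then have "S (- x) y w n e s" "(- p, q) \<in> cells (- x) y w n e s" "(- p', q') \<in> cells (- x) y w n e s"
    by auto
  then show "joined S (- p) q (- p') q'"
    unfolding joined_def by blast
next
  assume "joined S (- p) q (- p') q'"
  then obtain x y e n w s where "S x y e n w s"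
    "(- p, q) \<in> cells x y e n w s" "(- p', q') \<in> cells x y e n w s"
    unfolding joined_def by blast
  then have "S (- (- x)) y e n w s" "(p, q) \<in> cells (- x) y w n e s" "(p', q') \<in> cells (- x) y w n e s"
    by auto
  then show "joined (\<lambda>x y e n w s. S (- x) y w n e s) p q p' q'"
    unfolding joined_def by blast
qed

lemma joined_transpose:
  "joined (\<lambda>x y e n w s. S y x n e s w) p q p' q' \<longleftrightarrow> joined S q p q' p'"
proof
  assume "joined (\<lambda>x y e n w s. S y x n e s w) p q p' q'"
  then obtain x y e n w s where "S y x n e s w"
    "(p, q) \<in> cells x y e n w s" "(p', q') \<in> cells x y e n w s"
    unfolding joined_def by blast
  then have "S y x n e s w" "(q, p) \<in> cells y x n e s w" "(q', p') \<in> cells y x n e s w"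
    by auto
  then show "joined S q p q' p'"
    unfolding joined_def by blast
next
  assume "joined S q p q' p'"
  then obtain x y e n w s where "S x y e n w s"
    "(q, p) \<in> cells x y e n w s" "(q', p') \<in> cells x y e n w s"
    unfolding joined_def by blast
  then have "S x y e n w s" "(p, q) \<in> cells y x n e s w" "(p', q') \<in> cells y x n e s w"
    by auto
  then show "joined (\<lambda>x y e n w s. S y x n e s w) p q p' q'"
    unfolding joined_def by blast
qed

text \<open>Since either of the two arms may turn out to bound a pocket, \<open>a\<close> and
  \<open>c\<close> are not ordered, and \<open>exceptional\<close> speaks of both.\<close>

locale t_tiling = plane_tiling +
  fixes a b c :: int
  assumes a_ge: "2 \<le> a" and c_ge: "2 \<le> c" and b_ge: "3 \<le> b"
    and exceptional: "b = a + c + 1 \<Longrightarrow> a \<noteq> 2 \<and> c \<noteq> 2"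
    and shape: "S x y e n w s \<Longrightarrow>
      (n = b \<and> s = 0 \<or> n = 0 \<and> s = b) \<and> (e = a \<and> w = c \<or> e = c \<and> w = a) \<or>
      (e = b \<and> w = 0 \<or> e = 0 \<and> w = b) \<and> (n = a \<and> s = c \<or> n = c \<and> s = a)"
begin

lemma t_shift: "t_tiling (\<lambda>x y. S (x + p) (y + q)) a b c"
  by (intro t_tiling.intro shift t_tiling_axioms.intro a_ge b_ge c_ge) (drule exceptional shape, simp)+

lemma t_mirror: "t_tiling (\<lambda>x y e n w s. S (- x) y w n e s) a b c"
  by (intro t_tiling.intro mirror t_tiling_axioms.intro a_ge b_ge c_ge) (drule exceptional shape, argo)+

lemma t_transpose: "t_tiling (\<lambda>x y e n w s. S y x n e s w) a b c"
  by (intro t_tiling.intro transpose t_tiling_axioms.intro a_ge b_ge c_ge) (drule exceptional shape, argo)+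

lemma t_transpose_at: "t_tiling (\<lambda>x y e n w s. S (y + p) (x + q) n e s w) a b c"
  using t_tiling.t_transpose[OF t_shift[of p q]] by simp

lemma t_corner:
  assumes cut: "\<not> joined S (p - 1) q p q" "\<not> joined S p (q - 1) p q"
  obtains (up) k e n w where "1 \<le> k" "S p (q + k) e n w k"
    | (right) k e n s where "1 \<le> k" "S (p + k) q e n k s"
proof (rule corner[OF _ cut])
  show "0 < w \<or> 0 < s" if "S x y e n w s" for x y e n w s
    using shape[OF that] a_ge b_ge c_ge by linarith
qed (use that in blast)+

lemmas arm_bounds = a_ge b_ge c_ge

text \<open>Either two vertical bars stand back to back, or one arm is a hanging stem whose crossbar
  passes above the whole neighbouring bar of \<open>a + c + 1\<close> cells, which needs
  \<open>b > a + c\<close>.\<close>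

lemma adjacent_ends:
  assumes "S x (y + k) e n w k" "S (x + 1) (y + k') e' n' w' k'" "1 \<le> k" "1 \<le> k'"
  shows "e = 0 \<and> w' = 0 \<or> e = 0 \<and> n' = 0 \<and> k' = b \<and> a + c < b \<or>
    n = 0 \<and> k = b \<and> w' = 0 \<and> a + c < b"
  using apart[OF assms(1,2), simplified] shape[OF assms(1)] shape[OF assms(2)] arm_bounds assms(3,4)
  by (smt (verit))

lemma adjacent_ends_horizontal:
  assumes "S (x + k) y e n k s" "S (x + k') (y + 1) e' n' k' s'" "1 \<le> k" "1 \<le> k'"
  shows "n = 0 \<and> s' = 0 \<or> n = 0 \<and> e' = 0 \<and> k' = b \<and> a + c < b \<or>
    e = 0 \<and> k = b \<and> s' = 0 \<and> a + c < b"
  using apart[OF assms(1,2), simplified] shape[OF assms(1)] shape[OF assms(2)] arm_bounds assms(3,4)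
  by (smt (verit))

end

text \<open>The cells \<open>(1, 1), \<dots>, (w, 1)\<close> lie on a floor and between two walls that no tile crosses.\<close>

definition trough ::
    "(int \<Rightarrow> int \<Rightarrow> int \<Rightarrow> int \<Rightarrow> int \<Rightarrow> int \<Rightarrow> bool) \<Rightarrow> int \<Rightarrow> bool" where
  "trough S w \<longleftrightarrow> (\<forall>x. 1 \<le> x \<and> x \<le> w \<longrightarrow> \<not> joined S x 0 x 1) \<and>
     \<not> joined S 0 1 1 1 \<and> \<not> joined S w 1 (w + 1) 1"

section \<open>Narrow troughs, runs of arm ends, and pockets\<close>

context t_tiling
begin

lemma trough_cell:
  assumes "trough S w" "1 \<le> x" "x \<le> w"
  obtains (vertical) k e n v where "1 \<le> k" "S x (1 + k) e n v k"
    | (flat) X e v where "S X 1 e b v 0" "1 \<le> X - v" "X + e \<le> w" "X - v \<le> x" "x \<le> X + e"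
proof -
  obtain X Y e n v s where t: "S X Y e n v s" "(x, 1) \<in> cells X Y e n v s"
    by (rule covered)
  have nj: "(x', 0) \<notin> cells X Y e n v s" if "(x', 1) \<in> cells X Y e n v s" "1 \<le> x'" "x' \<le> w" for x'
    using assms(1) that t(1) unfolding trough_def joined_def by blast
  have "\<not> ((0, 1) \<in> cells X Y e n v s \<and> (1, 1) \<in> cells X Y e n v s)"
    "\<not> ((w, 1) \<in> cells X Y e n v s \<and> (w + 1, 1) \<in> cells X Y e n v s)"
    using assms(1) t(1) unfolding trough_def joined_def by blast+
  note walls = this[unfolded mem_cells] and t2 = t(2)[unfolded mem_cells]
  note nn = nonneg[OF t(1)]
  show thesis
  proof (cases "Y = 1")
    case True
    have h: "X - v \<le> x" "x \<le> X + e"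
      using t2 True nn by (smt (verit))+
    then have ends: "1 \<le> X - v" "X + e \<le> w"
      using walls True assms(2,3) by (smt (verit))+
    then have "s = 0"
      using nj[of X, unfolded mem_cells] True nn by (smt (verit))
    moreover from this have "n = b"
      using shape[OF t(1)] arm_bounds by (smt (verit))
    ultimately show thesis
      using flat t(1) True h ends by blast
  next
    case False
    then have "x = X" "Y - s = 1" "1 \<le> s"
      using t2 nn nj[OF t(2) assms(2,3), unfolded mem_cells] by (smt (verit))+
    then show thesis
      using vertical[of s e n v] t(1) by (metis diff_add_cancel)
  qed
qed

lemma narrow_trough:
  assumes "trough S w" "w \<le> a + c" "1 \<le> x" "x \<le> w"
  shows "\<exists>k e n v. 1 \<le> k \<and> S x (1 + k) e n v k"
  using assms(1,3,4)
proof (cases rule: trough_cell)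
  case (flat X e v)
  then show ?thesis
    using shape[OF flat(1)] assms(2) arm_bounds by (smt (verit))
qed blast

text \<open>By \<open>adjacent_ends\<close> the middle tile can suit both neighbours only as a
  hanging stem; the outer two are then bars that turn their flat sides towards it.\<close>

lemma three_ends:
  assumes "S x (1 + k) e n v k" "S (x + 1) (1 + k') e' n' v' k'" "S (x + 2) (1 + k'') e'' n'' v'' k''"
    and k: "1 \<le> k" "1 \<le> k'" "1 \<le> k''"
  shows "a + c < b \<and> v'' = 0"
proof -
  have t3: "S (x + 1 + 1) (1 + k'') e'' n'' v'' k''" using assms(3) by (simp add: add.commute)
  show ?thesis
    using adjacent_ends[OF assms(1,2) k(1,2)] adjacent_ends[OF assms(2) t3 k(2,3)]
      shape[OF assms(2)] shape[OF assms(3)] arm_bounds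
    by (smt (verit))
qed

text \<open>The second and the third tile would both be the hanging stem of a triple, yet the
  neighbours of such a stem are bars.\<close>

lemma no_four_ends:
  assumes "S x (1 + k) e n v k" "S (x + 1) (1 + k') e' n' v' k'" "S (x + 2) (1 + k'') e'' n'' v'' k''"
    "S (x + 3) (1 + k3) e3 n3 v3 k3"
    and k: "1 \<le> k" "1 \<le> k'" "1 \<le> k''" "1 \<le> k3"
  shows False
proof -
  have t: "S (x + 1 + 1) (1 + k'') e'' n'' v'' k''" "S (x + 1 + 2) (1 + k3) e3 n3 v3 k3"
    "S (x + 2 + 1) (1 + k3) e3 n3 v3 k3"
    using assms(3,4) by (simp_all add: algebra_simps)
  show ?thesis
    using three_ends[OF assms(1-3) k(1-3)] three_ends[OF assms(2) t(1,2) k(2-4)]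
      adjacent_ends[OF assms(3) t(3) k(3,4)] shape[OF assms(3)] arm_bounds
    by (smt (verit))
qed

lemma narrow_trough_width:
  assumes "trough S w" "w \<le> a + c" "3 \<le> w"
  shows "w = 3 \<and> a + c < b"
proof -
  note ends = narrow_trough[OF assms(1,2)]
  obtain k1 e1 n1 v1 where t1: "1 \<le> k1" "S 1 (1 + k1) e1 n1 v1 k1"
    using ends[of 1] assms(3) by auto
  obtain k2 e2 n2 v2 where t2: "1 \<le> k2" "S (1 + 1) (1 + k2) e2 n2 v2 k2"
    using ends[of "1 + 1"] assms(3) by auto
  obtain k3 e3 n3 v3 where t3: "1 \<le> k3" "S (1 + 2) (1 + k3) e3 n3 v3 k3"
    using ends[of "1 + 2"] assms(3) by auto
  have "\<not> 4 \<le> w"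
  proof
    assume "4 \<le> w"
    then obtain k e n v where t4: "1 \<le> k" "S (1 + 3) (1 + k) e n v k"
      using ends[of "1 + 3"] by auto
    show False
      by (rule no_four_ends[OF t1(2) t2(2) t3(2) t4(2) t1(1) t2(1) t3(1) t4(1)])
  qed
  then show ?thesis
    using three_ends[OF t1(2) t2(2) t3(2) t1(1) t2(1) t3(1)] assms(3) by auto
qed

text \<open>The lower arm of G is at least \<open>b \<ge> 3\<close>, so it is the arm length
  \<open>e\<close> and not 2. Seen sideways, the cells right of the stem of F form a trough of width
  \<open>b\<close> with that stem as floor. As \<open>b \<le> a + c - 2\<close>, it is narrow, and a
  narrow trough of width at least three requires \<open>a + c < b\<close>.\<close>

lemma pocket_ends_not_opposed:
  assumes F: "S 3 0 e b 2 0" and G: "S 2 (1 + k) b n 0 k" and k: "b \<le> k"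
  shows False
proof -
  note sF = shape[OF F] and sG = shape[OF G]
  have ke: "3 \<le> k" "k = e" "e \<le> a + c - 2"
    using sF sG k arm_bounds by (smt (verit))+
  \<comment> \<open>Beyond the tip of the stem the trough is closed by the stem of G if
    \<open>k = b\<close>. Otherwise \<open>(3, b + 1)\<close> is a corner between G and the tip, and
    only a horizontal arm can end there.\<close>
  have roof: "\<not> joined S 4 b 4 (b + 1)"
  proof (cases "k = b")
    case True
    show ?thesis
      by (rule not_joined(2)[OF G]; use True arm_bounds in simp)
  next
    case False
    have "\<not> joined S (3 - 1) (b + 1) 3 (b + 1)"
      by (rule not_joined(1)[OF G]; use sG k False arm_bounds in auto)
    moreover have "\<not> joined S 3 (b + 1 - 1) 3 (b + 1)"
      by (rule not_joined(1)[OF F]; use arm_bounds in simp)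
    ultimately show ?thesis
    proof (cases rule: t_corner)
      case (up q e' n' w')
      then show ?thesis
        using apart[OF G up(2)] shape[OF up(2)] sG ke k False arm_bounds by (smt (verit))
    next
      case (right q e' n' s')
      show ?thesis
        by (rule not_joined(2)[OF right(2)]; use shape[OF right(2)] right(1) arm_bounds in auto)
    qed
  qed
  interpret t: t_tiling "\<lambda>x y e n w s. S (y + 3) (x + 0) n e s w" a b c
    by (rule t_transpose_at)
  have F': "S (0 + 3) (0 + 0) e b 2 0" using F by simp
  have "trough (\<lambda>x y e n w s. S (y + 3) (x + 0) n e s w) b"
    unfolding trough_def
  proof (intro conjI allI impI)
    show "\<not> joined (\<lambda>x y e n w s. S (y + 3) (x + 0) n e s w) x 0 x 1" if "1 \<le> x \<and> x \<le> b" for x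
      by (rule t.not_joined(1)[OF F']; use that in simp)
    show "\<not> joined (\<lambda>x y e n w s. S (y + 3) (x + 0) n e s w) 0 1 1 1"
      by (rule t.not_joined(1)[OF F']; use ke in simp)
    show "\<not> joined (\<lambda>x y e n w s. S (y + 3) (x + 0) n e s w) b 1 (b + 1) 1"
      using roof joined_transpose[of "\<lambda>x y. S (x + 3) (y + 0)" b 1 "b + 1" 1] joined_shift[of S 3 0 1 b 1 "b + 1"]
      by simp
  qed
  then show False
    using t.narrow_trough_width[of b] ke k arm_bounds by linarith
qed

text \<open>A T standing on its bar with its stem up, and a wall just beyond the end of its left arm,
  enclose a pocket above that arm.  It has to be filled by the bar of a second T along the wall and the stem
  of a third one along the stem of the first.\<close>

lemma pocket:
  assumes F: "S (\<nu> + 1) 0 e b \<nu> 0" and m: "1 \<le> m"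
    and wall: "\<And>j. 1 \<le> j \<Longrightarrow> j \<le> m \<Longrightarrow> \<not> joined S 0 j 1 j"
  obtains k n e' w' where "\<nu> = 2" "a + c + 2 \<le> b" "m \<le> k" "S 1 (1 + k) 0 n b k" "S 2 (1 + b) e' 0 w' b"
proof -
  note sF = shape[OF F]
  have nu: "2 \<le> \<nu>" "\<nu> \<le> a + c - 2"
    using sF arm_bounds by (smt (verit))+
  have tr: "trough S \<nu>"
    unfolding trough_def
  proof (intro conjI allI impI)
    show "\<not> joined S x 0 x 1" if "1 \<le> x \<and> x \<le> \<nu>" for x
      by (rule not_joined(1)[OF F]; use that sF arm_bounds in auto)
    show "\<not> joined S 0 1 1 1" using wall m by simp
    show "\<not> joined S \<nu> 1 (\<nu> + 1) 1"
      by (rule not_joined(2)[OF F]; use arm_bounds in simp)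
  qed
  note ends = narrow_trough[OF tr]
  obtain k1 e1 n1 v1 where t1: "1 \<le> k1" "S 1 (1 + k1) e1 n1 v1 k1"
    using ends[of 1] nu by auto
  obtain k2 e2 n2 v2 where t2: "1 \<le> k2" "S (1 + 1) (1 + k2) e2 n2 v2 k2"
    using ends[of "1 + 1"] nu by auto
  \<comment> \<open>In a pocket of width three the last tile would be a vertical bar with its stem
    pointing right at a height at most \<open>a + c < b\<close>, straight into the stem of
    F.\<close>
  have "\<nu> = 2"
  proof (rule ccontr)
    assume "\<nu> \<noteq> 2"
    then have "\<nu> = 3" "a + c < b"
      using narrow_trough_width[OF tr] nu by auto
    obtain k3 e3 n3 v3 where t3: "1 \<le> k3" "S (1 + 2) (1 + k3) e3 n3 v3 k3"
      using ends[of "1 + 2"] \<open>\<nu> = 3\<close> nu by auto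
    have "v3 = 0"
      using three_ends[OF t1(2) t2(2) t3(2) t1(1) t2(1) t3(1)] by simp
    moreover have F4: "S 4 0 e b 3 0" and t3': "S 3 (1 + k3) e3 n3 v3 k3"
      using F t3 \<open>\<nu> = 3\<close> by simp_all
    ultimately show False
      using apart[OF F4 t3', simplified] shape[OF t3'] t3(1) \<open>a + c < b\<close> arm_bounds by (smt (verit))
  qed
  with F have F: "S 3 0 e b 2 0" by simp
  note s1 = shape[OF t1(2)] and s2 = shape[OF t2(2)]
  have "\<not> (e1 = 0 \<and> v2 = 0)"
  proof
    assume *: "e1 = 0 \<and> v2 = 0"
    then have "S 2 (1 + k2) b n2 0 k2" "b \<le> k2"
      using t2 s2 apart[OF F t2(2), simplified] arm_bounds by (simp, smt (verit))
    then show False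
      using pocket_ends_not_opposed[OF F] by blast
  qed
  then have big: "a + c < b" and "e1 = 0 \<and> n2 = 0 \<and> k2 = b \<or> n1 = 0 \<and> k1 = b \<and> v2 = 0"
    using adjacent_ends[OF t1(2) t2(2) t1(1) t2(1)] by blast+
  moreover have "v2 \<noteq> 0"
    using big t2(1) s2 apart[OF F t2(2), simplified] arm_bounds by (smt (verit))
  ultimately have *: "e1 = 0" "n2 = 0" "k2 = b" by auto
  then have v1: "v1 = b" using s1 t1(1) arm_bounds by (smt (verit))
  have "\<not> k1 < m"
  proof
    assume "k1 < m"
    then have "\<not> joined S 0 (1 + k1) 1 (1 + k1)" using wall t1(1) by simp
    moreover have "joined S 0 (1 + k1) 1 (1 + k1)"
      by (rule joinedI[OF t1(2)]; use v1 arm_bounds * in simp)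
    ultimately show False by contradiction
  qed
  \<comment> \<open>One of the arms is \<open>\<nu> = 2\<close>, so \<open>exceptional\<close>
    removes the value \<open>b = a + c + 1\<close>.\<close>
  moreover have "a + c + 2 \<le> b"
    using big exceptional sF \<open>\<nu> = 2\<close> arm_bounds by (smt (verit))
  ultimately show thesis
    using that[OF \<open>\<nu> = 2\<close>, of k1 n1 e2 v2] t1 t2 * v1 by auto
qed

text \<open>The stem of the bar along the wall must pass over the wall, so \<open>m \<le> k\<close>;
  but \<open>k \<le> a + c - 2 \<le> b - 4\<close>. The slack 3 permits a pocket raised by up to
  three rows beside a stem of length \<open>b\<close>.\<close>

lemma no_pocket_beside_high_wall:
  assumes F: "S (\<nu> + 1) 0 e b \<nu> 0" and m: "1 \<le> m" "a + c \<le> m \<or> b \<le> m + 3"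
    and wall: "\<And>j. 1 \<le> j \<Longrightarrow> j \<le> m \<Longrightarrow> \<not> joined S 0 j 1 j"
  shows False
proof (rule pocket[OF F m(1) wall])
  fix k n e' w'
  assume "a + c + 2 \<le> b" "m \<le> k" and G: "S 1 (1 + k) 0 n b k"
  then show False
    using shape[OF G] m arm_bounds by (smt (verit))
qed

end

section \<open>Troughs of width at least four\<close>

lemma mirror_trough:
  assumes "trough S w"
  shows "trough (\<lambda>x y e n v s. S (- x + (w + 1)) (y + 0) v n e s) w"
proof -
  have *: "joined (\<lambda>x y e n v s. S (- x + (w + 1)) (y + 0) v n e s) p q p' q' \<longleftrightarrow>
      joined S (w + 1 - p) q (w + 1 - p') q'" for p q p' q'
    using joined_mirror[of "\<lambda>x y. S (x + (w + 1)) (y + 0)" p q p' q']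
      joined_shift[of S "w + 1" 0 "- p" q "- p'" q'] by (simp add: algebra_simps)
  have sym: "joined S p q p' q' \<longleftrightarrow> joined S p' q' p q" for p q p' q'
    unfolding joined_def by blast
  show ?thesis
    using assms unfolding trough_def * by (auto simp: sym)
qed

context t_tiling
begin

lemma t_mirror_at: "t_tiling (\<lambda>x y e n w s. S (- x + p) (y + q) w n e s) a b c"
  using t_tiling.t_mirror[OF t_shift[of p q]] by simp

text \<open>Turned sideways, the bar of such a tile, its stem and the trough floor to its right
  enclose a pocket whose wall is that floor, of length \<open>w - p\<close>. The bar that
  \<open>pocket\<close> lays along the floor would run through the right wall of the trough.\<close>

lemma trough_end_right:
  assumes tr: "trough S w" and V: "S p (1 + k) b n 0 k" "1 \<le> k" "1 \<le> p" "p \<le> w"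
  shows "p = w"
proof (rule ccontr)
  assume "p \<noteq> w"
  then have p: "1 \<le> w - p" using V by simp
  interpret t: t_tiling "\<lambda>x y e n w s. S (y + p) (x + 0) n e s w" a b c
    by (rule t_transpose_at)
  have F: "S (0 + p) (k + 1 + 0) b n 0 k" using V by (simp add: add.commute)
  have "\<not> joined (\<lambda>x y e n w s. S (y + p) (x + 0) n e s w) 0 j 1 j" if "1 \<le> j" "j \<le> w - p" for j
    using that tr V joined_transpose[of "\<lambda>x y. S (x + p) (y + 0)" 0 j 1 j] joined_shift[of S p 0 j 0 j 1]
    unfolding trough_def by simp
  then show False
  proof (rule t.pocket[OF F p])
    fix k' n' e' w'
    assume k': "w - p \<le> k'" and G: "S (1 + k' + p) (1 + 0) n' 0 k' b"
    have "\<not> joined S w 1 (w + 1) 1" using tr unfolding trough_def by simp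
    moreover have "joined S w 1 (w + 1) 1"
      by (rule joinedI[OF G]; use k' p shape[OF G] arm_bounds in auto)
    ultimately show False by contradiction
  qed
qed

text \<open>By \<open>trough_end_right\<close> the vertical tile is a bar with its stem on the left
  or a hanging stem. It forms a wall of height \<open>a + c\<close> or \<open>b - 1\<close> beside
  the pocket on the left arm of the flat tile.\<close>

lemma no_flat_after_vertical:
  assumes tr: "trough S w" and V: "S p (1 + k) e' n' v' k" "1 \<le> k" "1 \<le> p" "p < w"
    and F: "S (p + 1 + \<nu>) 1 e b \<nu> 0"
  shows False
proof -
  interpret t: t_tiling "\<lambda>x y. S (x + p) (y + 1)" a b c by (rule t_shift)
  have F': "S (\<nu> + 1 + p) (0 + 1) e b \<nu> 0" using F by (simp add: algebra_simps)
  have V': "S (0 + p) (k + 1) e' n' v' k" using V by (simp add: algebra_simps)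
  note sV = shape[OF V(1)]
  have "\<not> (e' = b \<and> v' = 0)"
    using trough_end_right[OF tr, of p k n'] V by auto
  then consider "e' = 0" "k + n' = a + c" | "n' = 0" "k = b"
    using sV V(2) arm_bounds by (smt (verit))
  then show False
  proof cases
    case 1
    show False
    proof (rule t.no_pocket_beside_high_wall[OF F'])
      show "\<not> joined (\<lambda>x y. S (x + p) (y + 1)) 0 j 1 j" if "1 \<le> j" "j \<le> a + c" for j
        by (rule t.not_joined(1)[OF V']; use that 1 in simp)
    qed (use arm_bounds in auto)
  next
    case 2
    show False
    proof (rule t.no_pocket_beside_high_wall[OF F'])
      show "\<not> joined (\<lambda>x y. S (x + p) (y + 1)) 0 j 1 j" if "1 \<le> j" "j \<le> b - 1" for j
        by (rule t.not_joined(1)[OF V']; use that 2 in simp)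
    qed (use arm_bounds in auto)
  qed
qed

lemma no_vertical_after_flat:
  assumes tr: "trough S w" and V: "S p (1 + k) e' n' v' k" "1 \<le> k" "1 < p" "p \<le> w"
    and F: "S (p - 1 - \<nu>) 1 \<nu> b v 0"
  shows False
proof -
  interpret m: t_tiling "\<lambda>x y e n v s. S (- x + (w + 1)) (y + 0) v n e s" a b c
    by (rule t_mirror_at)
  have "S (- (w + 1 - p) + (w + 1)) (1 + k + 0) e' n' v' k"
    "S (- (w + 1 - p + 1 + \<nu>) + (w + 1)) (1 + 0) \<nu> b v 0" using V F by (simp_all add: algebra_simps)
  from m.no_flat_after_vertical[OF mirror_trough[OF tr] this(1) V(2) _ _ this(2)] show ?thesis
    using V by simp
qed

text \<open>For filling a trough from left to right: if the tile over the preceding cell stops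
  there, a flat bar over the current cell must begin at it.\<close>

lemma trough_next_cell:
  assumes tr: "trough S w" "1 \<le> x" "x \<le> w"
    and prev: "x = 1 \<or> (\<exists>X Y e n v s. S X Y e n v s \<and> (x - 1, 1) \<in> cells X Y e n v s \<and> (x, 1) \<notin> cells X Y e n v s)"
  obtains (vertical) k e n v where "1 \<le> k" "S x (1 + k) e n v k"
    | (flat) \<nu> e where "S (x + \<nu>) 1 e b \<nu> 0" "x + \<nu> + e \<le> w"
  using assms(1-3)
proof (cases rule: trough_cell)
  case (flat X e v)
  have "X - v = x"
  proof (rule ccontr)
    assume "X - v \<noteq> x"
    with flat have "x \<noteq> 1" "(x - 1, 1) \<in> cells X 1 e b v 0" "(x, 1) \<in> cells X 1 e b v 0" by auto
    with prev flat(1) unique show False by metis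
  qed
  then have "X = x + v" by simp
  with flat that(2) show thesis by blast
qed (rule that(1))

text \<open>No flat bar follows a vertical end, so otherwise the first four cells would all carry
  vertical ends.\<close>

lemma trough_starts_flat:
  assumes tr: "trough S w" and w: "4 \<le> w"
  obtains \<nu> e where "S (1 + \<nu>) 1 e b \<nu> 0" "1 + \<nu> + e \<le> w"
proof (rule ccontr)
  assume neg: "\<not> thesis"
  have first: "\<exists>k e n v. 1 \<le> k \<and> S 1 (1 + k) e n v k"
    using tr by (rule trough_next_cell[of w 1]) (use w neg that in auto)
  have step: "\<exists>k e n v. 1 \<le> k \<and> S (x + 1) (1 + k) e n v k"
    if "1 \<le> k" "S x (1 + k) e n v k" "1 \<le> x" "x < w" for x k e n v
  proof -
    have prev: "(x + 1 - 1, 1) \<in> cells x (1 + k) e n v k" "(x + 1, 1) \<notin> cells x (1 + k) e n v k"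
      using that nonneg[OF that(2)] by auto
    show ?thesis
    proof (rule trough_next_cell[OF tr, of "x + 1"])
      show "x + 1 = 1 \<or> (\<exists>X Y e n v s. S X Y e n v s \<and> (x + 1 - 1, 1) \<in> cells X Y e n v s \<and>
          (x + 1, 1) \<notin> cells X Y e n v s)"
        using prev that(2) by blast
    next
      fix \<nu> e'
      assume "S (x + 1 + \<nu>) 1 e' b \<nu> 0"
      then show ?thesis
        using no_flat_after_vertical[OF tr that(2,1,3,4)] by blast
    qed (use that in auto)
  qed
  obtain k1 e1 n1 v1 where t1: "1 \<le> k1" "S 1 (1 + k1) e1 n1 v1 k1"
    using first by blast
  obtain k2 e2 n2 v2 where t2: "1 \<le> k2" "S (1 + 1) (1 + k2) e2 n2 v2 k2"
    using step[OF t1] w by auto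
  obtain k3 e3 n3 v3 where t3: "1 \<le> k3" "S (1 + 2) (1 + k3) e3 n3 v3 k3"
    using step[OF t2] w by auto
  obtain k4 e4 n4 v4 where t4: "1 \<le> k4" "S (1 + 3) (1 + k4) e4 n4 v4 k4"
    using step[OF t3] w by auto
  show False
    by (rule no_four_ends[OF t1(2) t2(2) t3(2) t4(2) t1(1) t2(1) t3(1) t4(1)])
qed

text \<open>On the inner arms, between the two stems, lies another trough, of width
  \<open>e + \<nu>' \<ge> 4\<close>. Its first flat tile has a pocket beside the stem of F, which
  still rises \<open>b - 1\<close> rows above it.\<close>

lemma no_adjacent_flats:
  assumes F: "S (1 + \<nu>) 1 e b \<nu> 0" and G: "S (1 + \<nu> + e + 1 + \<nu>') 1 e' b \<nu>' 0"
  shows False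
proof -
  note sF = shape[OF F] and sG = shape[OF G]
  interpret t: t_tiling "\<lambda>x y. S (x + (1 + \<nu>)) (y + 1)" a b c by (rule t_shift)
  have F': "S (0 + (1 + \<nu>)) (0 + 1) e b \<nu> 0" using F by (simp add: algebra_simps)
  have G': "S (e + \<nu>' + 1 + (1 + \<nu>)) (0 + 1) e' b \<nu>' 0" using G by (simp add: algebra_simps)
  have arms: "2 \<le> e" "2 \<le> \<nu>'"
    using sF sG arm_bounds by auto
  have tr: "trough (\<lambda>x y. S (x + (1 + \<nu>)) (y + 1)) (e + \<nu>')"
    unfolding trough_def
  proof (intro conjI allI impI)
    show "\<not> joined (\<lambda>x y. S (x + (1 + \<nu>)) (y + 1)) x 0 x 1" if "1 \<le> x \<and> x \<le> e + \<nu>'" for x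
    proof (cases "x \<le> e")
      case True
      then show ?thesis
        by - (rule t.not_joined(1)[OF F']; use that sF arm_bounds in auto)
    next
      case False
      then show ?thesis
        by - (rule t.not_joined(1)[OF G']; use that sG arm_bounds in auto)
    qed
    show "\<not> joined (\<lambda>x y. S (x + (1 + \<nu>)) (y + 1)) 0 1 1 1"
      by (rule t.not_joined(1)[OF F']; use arms arm_bounds in simp)
    show "\<not> joined (\<lambda>x y. S (x + (1 + \<nu>)) (y + 1)) (e + \<nu>') 1 (e + \<nu>' + 1) 1"
      by (rule t.not_joined(2)[OF G']; use arms arm_bounds in simp)
  qed
  show False
  proof (rule t.trough_starts_flat[OF tr])
    show "4 \<le> e + \<nu>'" using arms by simp
    fix \<mu> f
    assume "S (1 + \<mu> + (1 + \<nu>)) (1 + 1) f b \<mu> 0"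
    then have H: "S (\<mu> + 1 + (1 + \<nu>)) (0 + (1 + 1)) f b \<mu> 0" by (simp add: algebra_simps)
    interpret r: t_tiling "\<lambda>x y. S (x + (1 + \<nu>)) (y + (1 + 1))" a b c by (rule t_shift)
    have F'': "S (0 + (1 + \<nu>)) (- 1 + (1 + 1)) e b \<nu> 0" using F by (simp add: algebra_simps)
    show False
    proof (rule r.no_pocket_beside_high_wall[OF H])
      show "\<not> joined (\<lambda>x y. S (x + (1 + \<nu>)) (y + (1 + 1))) 0 j 1 j" if "1 \<le> j" "j \<le> b - 1" for j
        by (rule r.not_joined(1)[OF F'']; use that in simp)
    qed (use arm_bounds in auto)
  qed
qed

text \<open>A flat bar comes first, and neither a vertical end nor another flat bar can follow
  it.\<close>

lemma trough_width:
  assumes tr: "trough S w" and w: "4 \<le> w"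
  shows "w = a + c + 1"
proof -
  obtain \<nu> e where F: "S (1 + \<nu>) 1 e b \<nu> 0" "1 + \<nu> + e \<le> w"
    by (rule trough_starts_flat[OF assms])
  have nu: "\<nu> + e = a + c" "2 \<le> \<nu>" "2 \<le> e"
    using shape[OF F(1)] arm_bounds by auto
  show ?thesis
  proof (rule ccontr)
    assume "w \<noteq> a + c + 1"
    then have *: "1 \<le> 1 + \<nu> + e + 1" "1 + \<nu> + e + 1 \<le> w" using F nu by auto
    have "(1 + \<nu> + e + 1 - 1, 1) \<in> cells (1 + \<nu>) 1 e b \<nu> 0"
      "(1 + \<nu> + e + 1, 1) \<notin> cells (1 + \<nu>) 1 e b \<nu> 0"
      using nu by auto
    with F(1) have prev: "1 + \<nu> + e + 1 = 1 \<or> (\<exists>X Y f n v s. S X Y f n v s \<and>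
        (1 + \<nu> + e + 1 - 1, 1) \<in> cells X Y f n v s \<and> (1 + \<nu> + e + 1, 1) \<notin> cells X Y f n v s)"
      by blast
    show False
    proof (rule trough_next_cell[OF tr * prev])
      fix k f n v
      assume "1 \<le> k" "S (1 + \<nu> + e + 1) (1 + k) f n v k"
      moreover have "S (1 + \<nu> + e + 1 - 1 - e) 1 e b \<nu> 0" using F by simp
      ultimately show False
        using no_vertical_after_flat[OF tr] * nu by (smt (verit))
    next
      fix \<mu> f
      assume "S (1 + \<nu> + e + 1 + \<mu>) 1 f b \<mu> 0"
      then show False using no_adjacent_flats[OF F(1)] by blast
    qed
  qed
qed

text \<open>At most two horizontal arms can be stacked against the stem below a vertical one: flat
  bars are excluded by the high wall, so the second arm must be a stem of length \<open>b\<close>,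
  and a third one would be flat again. The uncrossed edge below \<open>(2, i)\<close> is recorded as
  the wall of the pocket in \<open>no_bar_beside_stem\<close>.\<close>

lemma beside_stem:
  assumes O: "S 0 0 e b w 0"
  obtains i k e' n' w' where "1 \<le> i" "i \<le> 3" "1 \<le> k" "S 1 (i + k) e' n' w' k" "\<not> joined S 2 (i - 1) 2 i"
proof -
  note sO = shape[OF O]
  have wall: "\<not> joined S 0 j 1 j" if "1 \<le> j" "j \<le> b" for j
    by (rule not_joined(1)[OF O]; use that in simp)
  have no_flat: False if F: "S (1 + v) i f b v 0" and i: "1 \<le> i" "i \<le> 3" "i < b" for v i f
  proof -
    interpret t: t_tiling "\<lambda>x y. S (x + 0) (y + i)" a b c by (rule t_shift)
    have F': "S (v + 1 + 0) (0 + i) f b v 0" using F by (simp add: add.commute)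
    have O': "S (0 + 0) (- i + i) e b w 0" using O by simp
    show False
    proof (rule t.no_pocket_beside_high_wall[OF F'])
      show "\<not> joined (\<lambda>x y. S (x + 0) (y + i)) 0 j 1 j" if "1 \<le> j" "j \<le> b - i" for j
        by (rule t.not_joined(1)[OF O']; use that i in simp)
    qed (use i in auto)
  qed
  have "\<not> joined S (1 - 1) 1 1 1" using wall[of 1] arm_bounds by simp
  moreover have "\<not> joined S 1 (1 - 1) 1 1"
    by (rule not_joined(1)[OF O]; use sO arm_bounds in auto)
  ultimately show thesis
  proof (cases rule: t_corner)
    case (up k e' n' w')
    have "\<not> joined S 2 (1 - 1) 2 1"
      by (rule not_joined(1)[OF O]; use sO arm_bounds in auto)
    with up show thesis by (intro that[of 1 k]) auto
  next
    case (right w1 e1 n1 s1)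
    note T1 = right(2) and s1 = shape[OF right(2)]
    have w1: "2 \<le> w1" using s1 right(1) arm_bounds by auto
    have "s1 \<noteq> 0"
      using no_flat[of w1 1 e1] T1 s1 arm_bounds w1 by auto
    have "\<not> joined S (1 - 1) 2 1 2" using wall[of 2] arm_bounds by simp
    moreover have "\<not> joined S 1 (2 - 1) 1 2"
      by (rule not_joined(1)[OF T1]; use s1 w1 arm_bounds in auto)
    ultimately show thesis
    proof (cases rule: t_corner)
      case (up k e' n' w')
      have "\<not> joined S 2 (2 - 1) 2 2"
        by (rule not_joined(1)[OF T1]; use s1 w1 arm_bounds in auto)
      with up show thesis by (intro that[of 2 k]) auto
    next
      case r2: (right w2 e2 n2 s2)
      note T2 = r2(2) and s2 = shape[OF r2(2)]
      have w2: "2 \<le> w2" using s2 r2(1) arm_bounds by auto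
      have T2': "S (1 + w2) (1 + 1) e2 n2 w2 s2" using T2 by simp
      have "s2 \<noteq> 0"
        using no_flat[of w2 2 e2] T2 s2 arm_bounds w2 by auto
      then have *: "e2 = 0" "w2 = b" "a + c < b"
        using adjacent_ends_horizontal[OF T1 T2' right(1) r2(1)] \<open>s1 \<noteq> 0\<close> by auto
      have "\<not> joined S (1 - 1) 3 1 3" using wall[of 3] arm_bounds by simp
      moreover have "\<not> joined S 1 (3 - 1) 1 3"
        by (rule not_joined(1)[OF T2]; use * arm_bounds in simp)
      ultimately show thesis
      proof (cases rule: t_corner)
        case (up k e' n' w')
        have "\<not> joined S 2 (3 - 1) 2 3"
          by (rule not_joined(1)[OF T2]; use * arm_bounds in simp)
        with up show thesis by (intro that[of 3 k]) auto
      next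
        case r3: (right w3 e3 n3 s3)
        have T3: "S (1 + w3) (2 + 1) e3 n3 w3 s3" using r3 by simp
        have "s3 = 0"
          using adjacent_ends_horizontal[OF T2 T3 r2(1) r3(1)] s2 * arm_bounds by (smt (verit))
        then have False
          using no_flat[of w3 3 e3] r3 shape[OF r3(2)] * arm_bounds by auto
        then show thesis ..
      qed
    qed
  qed
qed

text \<open>Under the stem of R lies a sideways pocket whose wall is the single edge below
  \<open>(2, i)\<close>. It yields a tile G with its stem directly below that of R and its bar just
  beyond the tip of R. The upper parts of both bars and the stem of R bound a trough of width
  \<open>b\<close>, so \<open>b = a + c + 1\<close>, against the bound from
  \<open>pocket\<close>.\<close>

lemma no_bar_beside_stem:
  assumes R: "S 1 (i + k) e' n' 0 k" and k: "1 \<le> k" and cut: "\<not> joined S 2 (i - 1) 2 i"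
  shows False
proof -
  note sR = shape[OF R]
  have R': "e' = b" "2 \<le> k" "2 \<le> n'"
    using sR k arm_bounds by auto
  interpret t: t_tiling "\<lambda>x y e n w s. S (y + 1) (x + (i - 1)) n e s w" a b c
    by (rule t_transpose_at)
  have F: "S (0 + 1) (k + 1 + (i - 1)) b n' 0 k" using R R' by (simp add: add.commute)
  have wall: "\<not> joined (\<lambda>x y e n w s. S (y + 1) (x + (i - 1)) n e s w) 0 j 1 j" if "1 \<le> j" "j \<le> 1" for j
    using that cut joined_transpose[of "\<lambda>x y. S (x + 1) (y + (i - 1))" 0 j 1 j]
      joined_shift[of S 1 "i - 1" j 0 j 1] by simp
  show False
  proof (rule t.pocket[OF F order_refl wall])
    fix k1 n1 e2 w2
    assume "k = 2" and b: "a + c + 2 \<le> b" and "S (1 + b + 1) (2 + (i - 1)) 0 e2 b w2"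
    then have G: "S (b + 2) (i + 1) 0 e2 b w2" by (simp add: algebra_simps)
    interpret u: t_tiling "\<lambda>x y. S (x + 1) (y + (i + k))" a b c by (rule t_shift)
    have F': "S (0 + 1) (0 + (i + k)) b n' 0 k" using R R' by simp
    have G': "S (b + 1 + 1) (- 1 + (i + k)) 0 e2 b w2" using G \<open>k = 2\<close> by (simp add: algebra_simps)
    have "trough (\<lambda>x y. S (x + 1) (y + (i + k))) b"
      unfolding trough_def
    proof (intro conjI allI impI)
      show "\<not> joined (\<lambda>x y. S (x + 1) (y + (i + k))) x 0 x 1" if "1 \<le> x \<and> x \<le> b" for x
        by (rule u.not_joined(1)[OF F']; use that in simp)
      show "\<not> joined (\<lambda>x y. S (x + 1) (y + (i + k))) 0 1 1 1"
        by (rule u.not_joined(1)[OF F']; use R' in simp)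
      show "\<not> joined (\<lambda>x y. S (x + 1) (y + (i + k))) b 1 (b + 1) 1"
        by (rule u.not_joined(2)[OF G']; use shape[OF G] arm_bounds in auto)
    qed
    then show False
      using u.trough_width b arm_bounds by force
  qed
qed

lemma no_upright: "\<not> S 0 0 e b w 0"
proof
  assume O: "S 0 0 e b w 0"
  interpret m: t_tiling "\<lambda>x y e n w s. S (- x) y w n e s" a b c by (rule t_mirror)
  have O': "S (- 0) 0 e b w 0" using O by simp
  obtain i k e' n' w' where R: "1 \<le> i" "i \<le> 3" "1 \<le> k" "S 1 (i + k) e' n' w' k"
    "\<not> joined S 2 (i - 1) 2 i"
    by (rule beside_stem[OF O])
  obtain j l f n v where L: "1 \<le> j" "j \<le> 3" "1 \<le> l" "S (- 1) (j + l) v n f l"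
    "\<not> joined (\<lambda>x y e n w s. S (- x) y w n e s) 2 (j - 1) 2 j"
    by (rule m.beside_stem[OF O'])
  have "w' \<noteq> 0"
    using no_bar_beside_stem[of i k e' n'] R(3-5) by auto
  then have w': "2 \<le> w'"
    using shape[OF R(4)] arm_bounds by (smt (verit))
  have "v \<noteq> 0"
    using m.no_bar_beside_stem[of j l n f] L(3-5) by auto
  then have v: "2 \<le> v"
    using shape[OF L(4)] arm_bounds by (smt (verit))
  \<comment> \<open>The inner arms have length at least 2, so they pass over the tip of the stem and
    reach the column of the other tile. Both lower ends lie in rows at most
    \<open>3 \<le> b\<close>, so each centre would have to be above the other.\<close>
  have above: "b < i + k" "b < j + l"
    using apart[OF O R(4)] apart[OF O L(4)] R(1-3) L(1-3) w' v nonneg[OF R(4)] nonneg[OF L(4)]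
    by (smt (verit))+
  then show False
    using apart[OF L(4) R(4)] R(1-3) L(1-3) w' v nonneg[OF R(4)] nonneg[OF L(4)] arm_bounds
    by (smt (verit))
qed

lemma contradiction: False
proof -
  obtain x y e n w s where t: "S x y e n w s" by (rule covered[of 0 0])
  interpret o: t_tiling "\<lambda>u v. S (u + x) (v + y)" a b c by (rule t_shift)
  interpret r: t_tiling "\<lambda>u v e n w s. S (v + x) (u + y) n e s w" a b c by (rule t_transpose_at)
  interpret o': t_tiling "\<lambda>u v e n w s. S (u + x) (- v + y) e s w n" a b c
    using t_tiling.t_transpose[OF r.t_mirror] by simp
  interpret r': t_tiling "\<lambda>u v e n w s. S (- v + x) (u + y) s e n w" a b c
    using t_tiling.t_transpose[OF o.t_mirror] by simp
  have "\<not> S x y e b w 0" "\<not> S x y b n 0 s" "\<not> S x y e 0 w b" "\<not> S x y 0 n b s"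
    using o.no_upright[of e w] r.no_upright[of n s] o'.no_upright[of e w] r'.no_upright[of n s] by simp_all
  with t shape[OF t] show False by auto
qed

end

section \<open>From tilings to placed tiles and back\<close>

text \<open>Neither bar may be a single cell: a straight segment could be centred at any of its
  cells.\<close>

lemma cells_inject:
  assumes eq: "cells x y e n w s = cells x' y' e' n' w' s'"
    and nn: "0 \<le> e" "0 \<le> n" "0 \<le> w" "0 \<le> s" "0 \<le> e'" "0 \<le> n'" "0 \<le> w'" "0 \<le> s'"
    and "1 \<le> e \<or> 1 \<le> w" "1 \<le> n \<or> 1 \<le> s"
  shows "x = x' \<and> y = y' \<and> e = e' \<and> n = n' \<and> w = w' \<and> s = s'"
proof -
  have *: "(p, q) \<in> cells x y e n w s \<longleftrightarrow> (p, q) \<in> cells x' y' e' n' w' s'" for p q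
    using eq by simp
  note mem = this[unfolded mem_cells]
  have "x = x'"
    using mem[where p = x and q = "y + 1"] mem[where p = x and q = "y - 1"] mem[where p = "x" and q = y] assms(2-) by (smt (verit))
  moreover have "y = y'"
    using mem[where p = "x + 1" and q = y] mem[where p = "x - 1" and q = y] mem[where p = "x" and q = y] assms(2-) by (smt (verit))
  ultimately show ?thesis
    using mem[where p = "x + e" and q = y] mem[where p = "x + e'" and q = y] mem[where p = "x - w" and q = y] mem[where p = "x - w'" and q = y]
      mem[where p = x and q = "y + n"] mem[where p = x and q = "y + n'"] mem[where p = x and q = "y - s"] mem[where p = x and q = "y - s'"] nn
    by (smt (verit))
qed

lemma arms_nonneg:
  assumes "arms (int a) (int b) (int c) (int d) e n w s"
  shows "0 \<le> e" "0 \<le> n" "0 \<le> w" "0 \<le> s"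
    "1 \<le> a \<Longrightarrow> 1 \<le> b \<Longrightarrow> 1 \<le> c \<Longrightarrow> 1 \<le> e \<or> 1 \<le> w"
    "1 \<le> a \<Longrightarrow> 1 \<le> b \<Longrightarrow> 1 \<le> c \<Longrightarrow> 1 \<le> n \<or> 1 \<le> s"
  using assms unfolding arms_def by (elim disjE; simp)+

lemma plane_tiling_of_tiles:
  assumes "tiles (cross a b c d) plane" and pos: "1 \<le> a" "1 \<le> b" "1 \<le> c"
  obtains S where "plane_tiling S"
    "\<And>x y e n w s. S x y e n w s \<Longrightarrow> arms (int a) (int b) (int c) (int d) e n w s"
proof -
  obtain T where T: "\<And>C. C \<in> T \<Longrightarrow> is_copy (cross a b c d) C" "pairwise disjnt T" "\<Union> T = UNIV"
    using assms(1) unfolding tiles_def plane_def by blast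
  define S where "S x y e n w s \<longleftrightarrow>
    arms (int a) (int b) (int c) (int d) e n w s \<and> cells x y e n w s \<in> T" for x y e n w s
  have "plane_tiling S"
  proof (unfold_locales, goal_cases)
    case (1 x y e n w s)
    then have "arms (int a) (int b) (int c) (int d) e n w s" unfolding S_def by simp
    from arms_nonneg(1-4)[OF this] show ?case by simp
  next
    case (2 p q)
    obtain C where C: "C \<in> T" "(p, q) \<in> C" using T(3) by blast
    obtain x y e n w s where "arms (int a) (int b) (int c) (int d) e n w s" "C = cells x y e n w s"
      using T(1)[OF C(1)] unfolding is_copy_iff by (elim exE conjE)
    with C have "S x y e n w s \<and> (p, q) \<in> cells x y e n w s"
      unfolding S_def by simp
    then show ?case by (intro exI)
  next
    case (3 x y e n w s x' y' e' n' w' s' p q)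
    have eq: "cells x y e n w s = cells x' y' e' n' w' s'"
    proof (rule ccontr)
      assume "cells x y e n w s \<noteq> cells x' y' e' n' w' s'"
      then have "disjnt (cells x y e n w s) (cells x' y' e' n' w' s')"
        using 3(1,2) pairwiseD[OF T(2)] unfolding S_def by simp
      with 3(3,4) show False
        unfolding disjnt_iff by blast
    qed
    have "arms (int a) (int b) (int c) (int d) e n w s" "arms (int a) (int b) (int c) (int d) e' n' w' s'"
      using 3(1,2) unfolding S_def by simp_all
    then show ?case
      using cells_inject[OF eq] arms_nonneg pos by metis
  qed
  moreover have "arms (int a) (int b) (int c) (int d) e n w s" if "S x y e n w s" for x y e n w s
    using that unfolding S_def by simp
  ultimately show thesis by (rule that)

qed

lemma tiles_planeI:
  assumes arms: "\<And>x y e n w s. S x y e n w s \<Longrightarrow> arms (int a) (int b) (int c) (int d) e n w s"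
    and cover: "\<And>p q. \<exists>x y e n w s. S x y e n w s \<and> (p, q) \<in> cells x y e n w s"
    and unique: "\<And>x y e n w s x' y' e' n' w' s' p q. S x y e n w s \<Longrightarrow> S x' y' e' n' w' s' \<Longrightarrow>
      (p, q) \<in> cells x y e n w s \<Longrightarrow> (p, q) \<in> cells x' y' e' n' w' s' \<Longrightarrow>
      x = x' \<and> y = y' \<and> e = e' \<and> n = n' \<and> w = w' \<and> s = s'"
  shows "tiles (cross a b c d) plane"
proof -
  define T where "T = {cells x y e n w s | x y e n w s. S x y e n w s}"
  have "is_copy (cross a b c d) C" if "C \<in> T" for C
    using that arms unfolding T_def is_copy_iff by blast
  moreover have "pairwise disjnt T"
  proof (rule pairwiseI)
    fix C D assume "C \<in> T" "D \<in> T" "C \<noteq> D"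
    then obtain x y e n w s x' y' e' n' w' s' where
      C: "C = cells x y e n w s" "S x y e n w s" and D: "D = cells x' y' e' n' w' s'" "S x' y' e' n' w' s'"
      unfolding T_def by blast
    show "disjnt C D"
    proof (rule ccontr)
      assume "\<not> disjnt C D"
      then obtain p q where "(p, q) \<in> cells x y e n w s" "(p, q) \<in> cells x' y' e' n' w' s'"
        by (auto simp: disjnt_def C D simp del: mem_cells)
      from unique[OF C(2) D(2) this] show False
        using C D \<open>C \<noteq> D\<close> by simp
    qed
  qed
  moreover have "\<Union> T = UNIV"
  proof (rule UNIV_eq_I[symmetric])
    fix r :: cell
    obtain x y e n w s where "S x y e n w s" "(fst r, snd r) \<in> cells x y e n w s"
      using cover[of "fst r" "snd r"] by (elim exE conjE)
    then show "r \<in> \<Union> T"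
      unfolding T_def prod.collapse by blast
  qed
  ultimately show ?thesis
    unfolding tiles_def plane_def by blast
qed

text \<open>Disjointness is certified by a function that computes the centre of the covering tile
  from the cell alone, so pairs of tiles need not be compared.\<close>

lemma tiles_plane_by_owner:
  assumes arms: "\<And>x y e n w s. S x y e n w s \<Longrightarrow> arms (int a) (int b) (int c) (int d) e n w s"
    and functional: "\<And>x y e n w s e' n' w' s'. S x y e n w s \<Longrightarrow> S x y e' n' w' s' \<Longrightarrow>
      e = e' \<and> n = n' \<and> w = w' \<and> s = s'"
    and cover: "\<And>p q. \<exists>x y e n w s. S x y e n w s \<and> (p, q) \<in> cells x y e n w s"
    and owner: "\<And>x y e n w s p q. S x y e n w s \<Longrightarrow> (p, q) \<in> cells x y e n w s \<Longrightarrow> owner p q = (x, y)"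
  shows "tiles (cross a b c d) plane"
proof (rule tiles_planeI[OF arms cover])
  fix x y e n w s x' y' e' n' w' s' p q
  assume S: "S x y e n w s" "S x' y' e' n' w' s'"
    and "(p, q) \<in> cells x y e n w s" "(p, q) \<in> cells x' y' e' n' w' s'"
  then have "(x, y) = (x', y')"
    using owner by metis
  then show "x = x' \<and> y = y' \<and> e = e' \<and> n = n' \<and> w = w' \<and> s = s'"
    using functional[of x y e n w s e' n' w' s'] S by simp
qed

section \<open>Shapes that do not tile the plane\<close>

theorem cross_not_tiles:
  assumes pos: "1 \<le> a" "1 \<le> b" "1 \<le> c" "1 \<le> d" and "\<not> (a = 1 \<and> c = 1)" "\<not> (b = 1 \<and> d = 1)"
  shows "\<not> tiles (cross a b c d) plane"
proof
  assume "tiles (cross a b c d) plane"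
  then obtain S where S: "plane_tiling S"
    "\<And>x y e n w s. S x y e n w s \<Longrightarrow> arms (int a) (int b) (int c) (int d) e n w s"
    by (rule plane_tiling_of_tiles) (use pos in auto)
  define M where "M = Max {int a, int b, int c, int d}"
  have M: "int a \<le> M" "int b \<le> M" "int c \<le> M" "int d \<le> M"
    "M = int a \<or> M = int b \<or> M = int c \<or> M = int d"
    unfolding M_def by (auto simp: max_def)
  interpret plane_tiling S by (rule S(1))
  have two: "2 \<le> int a \<or> 2 \<le> int c" "2 \<le> int b \<or> 2 \<le> int d" "1 \<le> int a" "1 \<le> int b" "1 \<le> int c" "1 \<le> int d"
    using assms by auto
  have tile: "1 \<le> e \<and> e \<le> M \<and> 1 \<le> n \<and> n \<le> M \<and> 1 \<le> w \<and> w \<le> M \<and> 1 \<le> s \<and> s \<le> M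
      \<and> (2 \<le> e \<or> 2 \<le> w) \<and> (2 \<le> n \<or> 2 \<le> s) \<and> (M = e \<or> M = n \<or> M = w \<or> M = s)"
    if "S x y e n w s" for x y e n w s
    using S(2)[OF that] M two pos unfolding arms_def by (smt (verit))
  interpret cross_tiling S M
    by unfold_locales (drule tile, simp)
  obtain x y e n w s where t: "S x y e n w s" by (rule covered[of 0 0])
  interpret o: cross_tiling "\<lambda>u v. S (u + x) (v + y)" M by (rule cross_shift)
  interpret r: cross_tiling "\<lambda>u v e n w s. S (v + x) (u + y) n e s w" M by (rule o.cross_transpose)
  interpret o': cross_tiling "\<lambda>u v e n w s. S (u + x) (- v + y) e s w n" M
    using cross_tiling.cross_transpose[OF r.cross_mirror] by simp
  interpret r': cross_tiling "\<lambda>u v e n w s. S (- v + x) (u + y) s e n w" M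
    using cross_tiling.cross_transpose[OF o.cross_mirror] by simp
  have "\<not> S x y e M w s" "\<not> S x y M n w s" "\<not> S x y e n w M" "\<not> S x y e n M s"
    using o.no_long_arm[of e w s] r.no_long_arm[of n w s] o'.no_long_arm[of e n w] r'.no_long_arm[of e n s]
    by auto
  with t tile[OF t] show False by metis
qed

theorem t_not_tiles:
  assumes "2 \<le> c" "c \<le> a" "3 \<le> b" "\<not> (c = 2 \<and> b = a + 3)"
  shows "\<not> tiles (cross a b c 0) plane"
proof
  assume "tiles (cross a b c 0) plane"
  then obtain S where S: "plane_tiling S"
    "\<And>x y e n w s. S x y e n w s \<Longrightarrow> arms (int a) (int b) (int c) (int 0) e n w s"
    by (rule plane_tiling_of_tiles) (use assms in auto)
  interpret plane_tiling S by (rule S(1))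
  interpret t_tiling S "int a" "int b" "int c"
  proof (unfold_locales, goal_cases)
    case (5 x y e n w s)
    then show ?case using S(2)[OF 5] unfolding arms_def by auto
  qed (use assms in auto)
  show False by (rule contradiction)
qed

section \<open>Periodic tilings\<close>

lemma mod_eqI: "v = N * j + r \<Longrightarrow> 0 \<le> r \<Longrightarrow> r < N \<Longrightarrow> v mod N = r" for v N j r :: int
  by simp

lemma mod_expand:
  fixes v N :: int
  assumes "0 < N"
  obtains j r where "v = N * j + r" "0 \<le> r" "r < N" "v mod N = r"
proof
  show "v = N * (v div N) + v mod N" by simp
qed (use assms in auto)

text \<open>Here \<open>N\<close> is the number of cells of a tile and the centres have residue 0.
  The bar takes the residues \<open>-C\<close> to \<open>A\<close>; the factor \<open>A + 1\<close>
  gives the only remaining one to the stem cell.\<close>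

lemma tiles_t_stem_1: "tiles (cross a 1 c 0) plane"
proof -
  define A C where AC: "A = int a" "C = int c"
  then have nn: "0 \<le> A" "0 \<le> C" by simp_all
  define N where "N = A + C + 2"
  define g where "g x y = x + (A + 1) * y" for x y :: int
  have N: "0 < N" unfolding N_def using nn by simp
  define S where "S x y e n w s \<longleftrightarrow> N dvd g x y \<and> e = A \<and> n = 1 \<and> w = C \<and> s = 0"
    for x y e n w s :: int
  define owner where "owner p q = (let r = g p q mod N in
    if r \<le> A then (p - r, q) else if r = A + 1 then (p, q - 1) else (p - r + N, q))" for p q :: int
  show ?thesis
  proof (rule tiles_plane_by_owner[where S = S and owner = owner])
    fix p q
    obtain j r where r: "g p q = N * j + r" "0 \<le> r" "r < N"
      by (rule mod_expand[OF N])
    consider "r \<le> A" | "r = A + 1" | "A + 2 \<le> r" by linarith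
    then show "\<exists>x y e n w s. S x y e n w s \<and> (p, q) \<in> cells x y e n w s"
    proof cases
      case 1
      have "g (p - r) q = N * j" using r unfolding g_def by simp
      then have "S (p - r) q A 1 (C) 0 \<and> (p, q) \<in> cells (p - r) q A 1 (C) 0"
        unfolding S_def using nn r 1 by simp
      then show ?thesis by blast
    next
      case 2
      have "g p (q - 1) = N * j" using r 2 unfolding g_def by (simp add: algebra_simps)
      then have "S p (q - 1) A 1 (C) 0 \<and> (p, q) \<in> cells p (q - 1) A 1 (C) 0"
        unfolding S_def using nn by simp
      then show ?thesis by blast
    next
      case 3
      have "g (p - r + N) q = N * (j + 1)" using r unfolding g_def by (simp add: algebra_simps)
      then have "S (p - r + N) q A 1 (C) 0 \<and> (p, q) \<in> cells (p - r + N) q A 1 (C) 0"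
        unfolding S_def using nn r 3 N_def by simp
      then show ?thesis by blast
    qed
  next
    fix x y e n w s p q
    assume S: "S x y e n w s" and pq: "(p, q) \<in> cells x y e n w s"
    then obtain j where j: "g x y = N * j" unfolding S_def by (auto simp: dvd_def)
    have arms: "e = A" "n = 1" "w = C" "s = 0" using S unfolding S_def by auto
    consider "q = y" "x \<le> p" "p \<le> x + A" | "q = y" "p < x" "x - C \<le> p" | "p = x" "q = y + 1"
      using pq nn unfolding arms mem_cells by (smt (verit))
    then show "owner p q = (x, y)"
    proof cases
      case 1
      have "g p q mod N = p - x"
        by (rule mod_eqI[of _ _ j]) (use 1 j nn in \<open>auto simp: g_def N_def\<close>)
      then show ?thesis unfolding owner_def using nn 1 by simp
    next
      case 2
      have "g p q mod N = p - x + N"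
        by (rule mod_eqI[of _ _ "j - 1"]) (use 2 j nn in \<open>auto simp: g_def N_def algebra_simps\<close>)
      then show ?thesis unfolding owner_def using nn 2 by (simp add: N_def)
    next
      case 3
      have "g p q mod N = A + 1"
        by (rule mod_eqI[of _ _ j]) (use 3 j nn in \<open>auto simp: g_def N_def algebra_simps\<close>)
      then show ?thesis unfolding owner_def using nn 3 by simp
    qed
  qed (auto simp: S_def arms_def AC)
qed

text \<open>Modulo twice the number of cells, upright copies are centred at residue 0 and
  half-turned ones at \<open>2 * A + 1\<close>. Their bars take the residues from -1 to
  \<open>2 * A + 2\<close>. A step up lowers \<open>g\<close> by two, so the upright stems take the
  even residues that remain and the hanging stems the odd ones.\<close>

lemma tiles_t_left_1: "tiles (cross a b 1 0) plane"
proof -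
  define A B where AB: "A = int a" "B = int b"
  then have nn: "0 \<le> A" "0 \<le> B" by simp_all
  define N where "N = 2 * (A + B + 2)"
  define g where "g x y = x - 2 * y" for x y :: int
  have N: "0 < N" unfolding N_def using nn by simp
  define S where "S x y e n w s \<longleftrightarrow> N dvd g x y \<and> e = A \<and> n = B \<and> w = 1 \<and> s = 0 \<or>
      N dvd g x y - (2 * A + 1) \<and> e = 1 \<and> n = 0 \<and> w = A \<and> s = B"
    for x y e n w s :: int
  define owner where "owner p q = (let r = g p q mod N in
    if r \<le> A then (p - r, q)
    else if r \<le> 2 * A + 2 then (p - r + (2 * A + 1), q)
    else if r = N - 1 then (p + 1, q)
    else if even r then (p, q - (N - r) div 2)
    else (p, q + (r - 2 * A - 1) div 2))" for p q :: int
  show ?thesis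
  proof (rule tiles_plane_by_owner[where S = S and owner = owner])
    fix p q
    obtain j r where r: "g p q = N * j + r" "0 \<le> r" "r < N"
      by (rule mod_expand[OF N])
    consider "r \<le> A" | "A < r" "r \<le> 2 * A + 2" | "r = N - 1" | "2 * A + 2 < r" "even r"
      | "2 * A + 2 < r" "r \<noteq> N - 1" "odd r"
      by linarith
    then show "\<exists>x y e n w s. S x y e n w s \<and> (p, q) \<in> cells x y e n w s"
    proof cases
      case 1
      have "g (p - r) q = N * j" using r unfolding g_def by simp
      then have "S (p - r) q A B 1 0 \<and> (p, q) \<in> cells (p - r) q A B 1 0"
        unfolding S_def using nn r 1 by simp
      then show ?thesis by blast
    next
      case 2
      have "g (p - r + (2 * A + 1)) q - (2 * A + 1) = N * j" using r unfolding g_def by simp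
      then have "S (p - r + (2 * A + 1)) q 1 0 A B \<and>
          (p, q) \<in> cells (p - r + (2 * A + 1)) q 1 0 A B"
        unfolding S_def using nn r 2 by simp
      then show ?thesis by blast
    next
      case 3
      have "g (p + 1) q = N * (j + 1)" using r 3 unfolding g_def by (simp add: algebra_simps)
      then have "S (p + 1) q A B 1 0 \<and> (p, q) \<in> cells (p + 1) q A B 1 0"
        unfolding S_def using nn by simp
      then show ?thesis by blast
    next
      case 4
      from \<open>even r\<close> obtain h where "r = 2 * h" by (rule evenE)
      then obtain t where 4: "r = N - 2 * t" "1 \<le> t" "t \<le> B"
        using 4 r(3) that[of "A + B + 2 - h"] unfolding N_def by simp
      have "g p (q - t) = N * (j + 1)" using r 4 unfolding g_def by (simp add: algebra_simps)
      then have "S p (q - t) A B 1 0 \<and> (p, q) \<in> cells p (q - t) A B 1 0"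
        unfolding S_def using nn 4 by simp
      then show ?thesis by blast
    next
      case 5
      from \<open>odd r\<close> obtain h where "r = 2 * h + 1" by (rule oddE)
      then obtain t where 5: "r = 2 * A + 1 + 2 * t" "1 \<le> t" "t \<le> B"
        using 5 r(3) that[of "h - A"] unfolding N_def by simp
      have "g p (q + t) - (2 * A + 1) = N * j" using r 5 unfolding g_def by (simp add: algebra_simps)
      then have "S p (q + t) 1 0 A B \<and> (p, q) \<in> cells p (q + t) 1 0 A B"
        unfolding S_def using nn 5 by simp
      then show ?thesis by blast
    qed
  next
    fix x y e n w s p q
    assume S: "S x y e n w s" and pq: "(p, q) \<in> cells x y e n w s"
    have even: "even N" unfolding N_def by simp
    from S show "owner p q = (x, y)"
      unfolding S_def
    proof (elim disjE conjE)
      assume "N dvd g x y" and arms: "e = A" "n = B" "w = 1" "s = 0"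
      then obtain j where j: "g x y = N * j" by (auto simp: dvd_def)
      consider "q = y" "x \<le> p" "p \<le> x + A" | "q = y" "p = x - 1"
        | "p = x" "y < q" "q \<le> y + B"
        using pq nn unfolding arms mem_cells by (smt (verit))
      then show ?thesis
      proof cases
        case 1
        have "g p q mod N = p - x"
          by (rule mod_eqI[of _ _ j]) (use 1 j nn in \<open>auto simp: g_def N_def\<close>)
        then show ?thesis unfolding owner_def using nn 1 by simp
      next
        case 2
        have "g p q mod N = N - 1"
          by (rule mod_eqI[of _ _ "j - 1"]) (use 2 j nn in \<open>auto simp: g_def N_def algebra_simps\<close>)
        then show ?thesis unfolding owner_def using nn 2 by (simp add: N_def)
      next
        case 3
        define t where "t = q - y"
        have 3: "p = x" "q = y + t" "1 \<le> t" "t \<le> B" using 3 unfolding t_def by simp_all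
        have "g p q mod N = N - 2 * t"
          by (rule mod_eqI[of _ _ "j - 1"]) (use 3 j nn in \<open>auto simp: g_def N_def algebra_simps\<close>)
        moreover have "even (N - 2 * t)" using even by simp
        moreover have "2 * A + 2 < N - 2 * t" "N - 2 * t \<noteq> N - 1" using 3 unfolding N_def by simp_all
        ultimately show ?thesis unfolding owner_def using nn 3 by simp
      qed
    next
      assume "N dvd g x y - (2 * A + 1)" and arms: "e = 1" "n = 0" "w = A" "s = B"
      then obtain j where j: "g x y = N * j + (2 * A + 1)"
        by (metis diff_eq_eq dvdE)
      consider "q = y" "x - A \<le> p" "p \<le> x + 1"
        | "p = x" "q < y" "y - B \<le> q"
        using pq nn unfolding arms mem_cells by (smt (verit))
      then show ?thesis
      proof cases
        case 1
        have "g p q mod N = p - x + (2 * A + 1)"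
          by (rule mod_eqI[of _ _ j]) (use 1 j nn in \<open>auto simp: g_def N_def\<close>)
        then show ?thesis unfolding owner_def using nn 1 by simp
      next
        case 2
        define t where "t = y - q"
        have 2: "p = x" "q = y - t" "1 \<le> t" "t \<le> B" using 2 unfolding t_def by simp_all
        have "g p q mod N = 2 * A + 1 + 2 * t"
          by (rule mod_eqI[of _ _ j]) (use 2 j nn in \<open>auto simp: g_def N_def algebra_simps\<close>)
        moreover have "2 * A + 1 + 2 * t \<noteq> N - 1" using 2 unfolding N_def by presburger
        ultimately show ?thesis unfolding owner_def using nn 2 by simp
      qed
    qed
  next
    fix x y e n w s e' n' w' s'
    assume "S x y e n w s" "S x y e' n' w' s'"
    moreover have False if "N dvd g x y" "N dvd g x y - (2 * A + 1)"
    proof -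
      have "N dvd 2 * A + 1" using dvd_diff[OF that] by simp
      then show False using zdvd_imp_le[of N "2 * A + 1"] nn unfolding N_def by simp
    qed
    ultimately show "e = e' \<and> n = n' \<and> w = w' \<and> s = s'"
      unfolding S_def by metis
  qed (auto simp: S_def arms_def AB)
qed

text \<open>Cells are classed by row parity and by \<open>g\<close> modulo the number
  \<open>N\<close> of cells of a tile. The bars miss two residues in each parity: one is taken by
  the middle stem cell of the opposite orientation, the other by the stem tip of the same
  orientation, moved there by the shift \<open>C + 1\<close> per two rows.\<close>

lemma tiles_t_stem_2: "tiles (cross a 2 c 0) plane"
proof -
  define A C where AC: "A = int a" "C = int c"
  then have nn: "0 \<le> A" "0 \<le> C" by simp_all
  define N where "N = A + C + 3"
  define g where "g x y = x - (y div 2) * (C + 1)" for x y :: int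
  have N: "0 < N" unfolding N_def using nn by simp
  have g_right: "g (x + t) y = g x y + t" for x y t
    unfolding g_def by simp
  have g_up2: "g x (y + 2) = g x y - (C + 1)" for x y
  proof -
    have "(y + 2) div 2 = y div 2 + 1" by simp
    then show ?thesis unfolding g_def by (simp only:) (simp add: algebra_simps)
  qed
  have g_up: "even y \<Longrightarrow> g x (y + 1) = g x y" for x y
    unfolding g_def by simp
  define S where "S x y e n w s \<longleftrightarrow>
      even y \<and> N dvd g x y \<and> e = A \<and> n = 2 \<and> w = C \<and> s = 0 \<or>
      odd y \<and> N dvd g x y - (A + 1) \<and> e = C \<and> n = 0 \<and> w = A \<and> s = 2"
    for x y e n w s :: int
  define owner where "owner p q = (let r = g p q mod N in
    if even q then
      if r \<le> A then (p - r, q) else if r = A + 1 then (p, q + 1) else if r = A + 2 then (p, q - 2)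
      else (p - r + N, q)
    else if r = 0 then (p, q - 1) else if r = N - 1 then (p, q + 2) else (p - r + (A + 1), q))"
    for p q :: int
  show ?thesis
  proof (rule tiles_plane_by_owner[where S = S and owner = owner])
    fix p q
    obtain j r where r: "g p q = N * j + r" "0 \<le> r" "r < N"
      by (rule mod_expand[OF N])
    have up: "S x y A 2 C 0" if "even y" "g x y = N * i" for x y i
      unfolding S_def using that by simp
    have down: "S x y C 0 A 2" if "odd y" "g x y = N * i + (A + 1)" for x y i
      unfolding S_def using that by simp
    show "\<exists>x y e n w s. S x y e n w s \<and> (p, q) \<in> cells x y e n w s"
    proof (cases "even q")
      case True
      consider "r \<le> A" | "r = A + 1" | "r = A + 2" | "A + 3 \<le> r" by linarith
      then show ?thesis
      proof cases
        case 1
        have "S (p + - r) q A 2 C 0"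
          by (rule up[of _ _ j]) (use True r g_right[of p "- r" q] in simp_all)
        moreover have "(p, q) \<in> cells (p + - r) q A 2 C 0" using 1 r nn by simp
        ultimately show ?thesis by blast
      next
        case 2
        have "S p (q + 1) C 0 A 2"
          by (rule down[of _ _ j]) (use True r 2 in \<open>simp_all add: g_up\<close>)
        moreover have "(p, q) \<in> cells p (q + 1) C 0 A 2" by simp
        ultimately show ?thesis by blast
      next
        case 3
        have "S p (q - 2) A 2 C 0"
          by (rule up[of _ _ "j + 1"])
            (use True r 3 g_up2[of p "q - 2"] in \<open>simp_all add: N_def algebra_simps\<close>)
        moreover have "(p, q) \<in> cells p (q - 2) A 2 C 0" by simp
        ultimately show ?thesis by blast
      next
        case 4
        have "S (p + (N - r)) q A 2 C 0"
          by (rule up[of _ _ "j + 1"]) (use True r g_right[of p "N - r" q] in \<open>simp_all add: algebra_simps\<close>)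
        moreover have "(p, q) \<in> cells (p + (N - r)) q A 2 C 0" using 4 r nn by (simp add: N_def)
        ultimately show ?thesis by blast
      qed
    next
      case False
      consider "r = 0" | "r = N - 1" | "1 \<le> r" "r \<le> N - 2" using r by linarith
      then show ?thesis
      proof cases
        case 1
        have "S p (q - 1) A 2 C 0"
          by (rule up[of _ _ j]) (use False r 1 g_up[of "q - 1" p] in simp_all)
        moreover have "(p, q) \<in> cells p (q - 1) A 2 C 0" by simp
        ultimately show ?thesis by blast
      next
        case 2
        have "S p (q + 2) C 0 A 2"
          by (rule down[of _ _ j]) (use False r 2 in \<open>simp_all add: g_up2 N_def\<close>)
        moreover have "(p, q) \<in> cells p (q + 2) C 0 A 2" by simp
        ultimately show ?thesis by blast
      next
        case 3
        have "S (p + (A + 1 - r)) q C 0 A 2"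
          by (rule down[of _ _ j]) (use False r in \<open>simp_all add: g_right\<close>)
        moreover have "(p, q) \<in> cells (p + (A + 1 - r)) q C 0 A 2" using 3 nn by (simp add: N_def)
        ultimately show ?thesis by blast
      qed
    qed
  next
    fix x y e n w s p q
    assume S: "S x y e n w s" and pq: "(p, q) \<in> cells x y e n w s"
    have g_bar: "g p y = g x y + (p - x)" for p x y
      using g_right[of x "p - x" y] by simp
    from S show "owner p q = (x, y)"
      unfolding S_def
    proof (elim disjE conjE)
      assume y: "even y" and "N dvd g x y" and arms: "e = A" "n = 2" "w = C" "s = 0"
      then obtain j where j: "g x y = N * j" by (auto simp: dvd_def)
      consider "q = y" "x \<le> p" "p \<le> x + A" | "q = y" "p < x" "x - C \<le> p" | "p = x" "q = y + 1"
        | "p = x" "q = y + 2"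
        using pq nn unfolding arms mem_cells by (smt (verit))
      then show ?thesis
      proof cases
        case 1
        have "g p q mod N = p - x"
          by (rule mod_eqI[of _ _ j]) (use 1 j nn in \<open>auto simp: g_bar[of p y x] N_def\<close>)
        then show ?thesis unfolding owner_def using 1 y by simp
      next
        case 2
        have "g p q mod N = p - x + N"
          by (rule mod_eqI[of _ _ "j - 1"]) (use 2 j nn in \<open>auto simp: g_bar[of p y x] N_def algebra_simps\<close>)
        then show ?thesis unfolding owner_def using 2 y by (simp add: N_def)
      next
        case 3
        have "g p q mod N = 0"
          by (rule mod_eqI[of _ _ j]) (use 3 j y N in \<open>auto simp: g_up\<close>)
        then show ?thesis unfolding owner_def using 3 y by simp
      next
        case 4
        have "g p q mod N = A + 2"
          by (rule mod_eqI[of _ _ "j - 1"]) (use 4 j nn in \<open>auto simp: g_up2 N_def algebra_simps\<close>)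
        then show ?thesis unfolding owner_def using 4 y by simp
      qed
    next
      assume y: "odd y" and "N dvd g x y - (A + 1)" and arms: "e = C" "n = 0" "w = A" "s = 2"
      then obtain j where j: "g x y = N * j + (A + 1)"
        by (metis diff_eq_eq dvdE)
      consider "q = y" "x - A \<le> p" "p \<le> x + C" | "p = x" "q = y - 1" | "p = x" "q = y - 2"
        using pq nn unfolding arms mem_cells by (smt (verit))
      then show ?thesis
      proof cases
        case 1
        have "g p q mod N = p - x + (A + 1)"
          by (rule mod_eqI[of _ _ j]) (use 1 j nn in \<open>auto simp: g_bar[of p y x] N_def\<close>)
        then show ?thesis unfolding owner_def using 1 y nn by (simp add: N_def)
      next
        case 2
        have "g p q mod N = A + 1"
          by (rule mod_eqI[of _ _ j]) (use 2 j nn y g_up[of "y - 1" x] in \<open>auto simp: N_def\<close>)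
        then show ?thesis unfolding owner_def using 2 y by simp
      next
        case 3
        have "g p q mod N = N - 1"
          by (rule mod_eqI[of _ _ j]) (use 3 j nn g_up2[of x "y - 2"] in \<open>auto simp: N_def\<close>)
        then show ?thesis unfolding owner_def using 3 y nn by (simp add: N_def)
      qed
    qed
  qed (auto simp: S_def arms_def AC)
qed

text \<open>Modulo the number \<open>N\<close> of cells, the vertical bars fill the residues 0 to
  \<open>N - 3\<close> of every column; \<open>N - 1\<close> and \<open>N - 2\<close> receive the
  side arms from the left and right neighbour columns. Tiles in odd columns are upside down, and
  \<open>off\<close> is both the length of the lower arm and the residue of the centre.\<close>

lemma tiles_cross_1_1: "tiles (cross 1 b 1 d) plane"
proof -
  define B D where BD: "B = int b" "D = int d"
  then have nn: "0 \<le> B" "0 \<le> D" by simp_all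
  define N where "N = B + D + 3"
  define g where "g x y = y + x div 2 - (if even x then 0 else D + 1)" for x y :: int
  define off where "off x = (if even x then D else B)" for x :: int
  have N: "0 < N" unfolding N_def using nn by simp
  have g_up: "g x (y + t) = g x y + t" for x y t
    unfolding g_def by simp
  have g_right: "g (x + 1) y = g x y + (if even x then - (D + 1) else D + 2)" for x y
    unfolding g_def by (auto elim!: evenE oddE)
  define S where "S x y e n w s \<longleftrightarrow>
      N dvd g x y - off x \<and> e = 1 \<and> n = B + D - off x \<and> w = 1 \<and> s = off x"
    for x y e n w s :: int
  define owner where "owner p q = (let r = g p q mod N in
    if r \<le> N - 3 then (p, q - r + off p) else if r = N - 1 then (p - 1, q) else (p + 1, q))"
    for p q :: int
  have off: "0 \<le> off x" "off x \<le> B + D" for x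
    unfolding off_def using nn by simp_all
  show ?thesis
  proof (rule tiles_plane_by_owner[where S = S and owner = owner])
    fix p q
    obtain j r where r: "g p q = N * j + r" "0 \<le> r" "r < N"
      by (rule mod_expand[OF N])
    have S: "S x y 1 (B + D - off x) 1 (off x)" if "g x y = N * i + off x" for x y i
      unfolding S_def using that by simp
    consider "r \<le> N - 3" | "r = N - 1" | "r = N - 2" using r by linarith
    then show "\<exists>x y e n w s. S x y e n w s \<and> (p, q) \<in> cells x y e n w s"
    proof cases
      case 1
      have "S p (q + (off p - r)) 1 (B + D - off p) 1 (off p)"
        by (rule S[of _ _ j]) (use r in \<open>simp add: g_up\<close>)
      moreover have "(p, q) \<in> cells p (q + (off p - r)) 1 (B + D - off p) 1 (off p)"
        using 1 r by (simp add: N_def)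
      ultimately show ?thesis by blast
    next
      case 2
      have "S (p - 1) q 1 (B + D - off (p - 1)) 1 (off (p - 1))"
        by (rule S[of _ _ "if even p then j else j + 1"])
          (use r 2 g_right[of "p - 1" q] in \<open>auto simp: off_def N_def algebra_simps split: if_splits\<close>)
      moreover have "(p, q) \<in> cells (p - 1) q 1 (B + D - off (p - 1)) 1 (off (p - 1))" by simp
      ultimately show ?thesis by blast
    next
      case 3
      have "S (p + 1) q 1 (B + D - off (p + 1)) 1 (off (p + 1))"
        by (rule S[of _ _ "if even p then j else j + 1"])
          (use r 3 g_right[of p q] in \<open>auto simp: off_def N_def algebra_simps split: if_splits\<close>)
      moreover have "(p, q) \<in> cells (p + 1) q 1 (B + D - off (p + 1)) 1 (off (p + 1))" by simp
      ultimately show ?thesis by blast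
    qed
  next
    fix x y e n w s p q
    assume S: "S x y e n w s" and pq: "(p, q) \<in> cells x y e n w s"
    then obtain j where j: "g x y = N * j + off x"
      unfolding S_def by (metis diff_eq_eq dvdE)
    have arms: "e = 1" "n = B + D - off x" "w = 1" "s = off x" using S unfolding S_def by auto
    consider "p = x" "y - off x \<le> q" "q \<le> y + (B + D - off x)" | "q = y" "p = x + 1" | "q = y" "p = x - 1"
      using pq off[of x] unfolding arms mem_cells by (smt (verit))
    then show "owner p q = (x, y)"
    proof cases
      case 1
      have "g p q mod N = off x + (q - y)"
        by (rule mod_eqI[of _ _ j]) (use 1 j g_up[of x y "q - y"] in \<open>auto simp: N_def\<close>)
      then show ?thesis unfolding owner_def using 1 by (simp add: N_def)
    next
      case 2
      have "g p q mod N = N - 1"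
        by (rule mod_eqI[of _ _ "if even x then j - 1 else j"])
          (use 2 j nn g_right[of x y] in \<open>auto simp: off_def N_def algebra_simps split: if_splits\<close>)
      then show ?thesis unfolding owner_def using 2 by simp
    next
      case 3
      have "g p q mod N = N - 2"
        by (rule mod_eqI[of _ _ "if even x then j - 1 else j"])
          (use 3 j nn g_right[of "x - 1" y] in \<open>auto simp: off_def N_def algebra_simps split: if_splits\<close>)
      then show ?thesis unfolding owner_def using 3 by simp
    qed
  qed (auto simp: S_def arms_def BD off_def)
qed

text \<open>Four copies, related in pairs by half turns, repeat along the lattice generated by
  \<open>(4, 4)\<close> and \<open>(- b, b)\<close>; here \<open>m\<close> stands for a multiple of \<open>b\<close>.\<close>

definition quad :: "int \<Rightarrow> int \<Rightarrow> int \<Rightarrow> int \<Rightarrow> int \<Rightarrow> int \<Rightarrow> int \<Rightarrow> int \<Rightarrow> int \<Rightarrow> bool" where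
  "quad b i m x y e n w s \<longleftrightarrow>
     (x = 4 * i - m \<and> y = 4 * i + m \<and> e = b \<and> n = b - 3 \<and> w = 0 \<and> s = 2) \<or>
     (x = 4 * i - m + 3 \<and> y = 4 * i + m + 1 \<and> e = b - 3 \<and> n = b \<and> w = 2 \<and> s = 0) \<or>
     (x = 4 * i - m + b + 1 \<and> y = 4 * i + m - 1 \<and> e = 0 \<and> n = 2 \<and> w = b \<and> s = b - 3) \<or>
     (x = 4 * i - m + b - 2 \<and> y = 4 * i + m - 2 \<and> e = 2 \<and> n = 0 \<and> w = b - 3 \<and> s = b)"

text \<open>With \<open>u = p - q + 2 * m\<close> and \<open>h = q - m\<close>, the tile of \<open>quad b _ m\<close> that contains
  \<open>(p, q)\<close>, first through its horizontal and then through its vertical bar.\<close>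

definition quad_at :: "int \<Rightarrow> int \<Rightarrow> int \<Rightarrow> int \<Rightarrow> int \<Rightarrow> int \<Rightarrow> int \<Rightarrow> int \<Rightarrow> int \<Rightarrow> int \<Rightarrow> int \<Rightarrow> bool" where
  "quad_at b u h p q x y e n w s \<longleftrightarrow>
     (h mod 4 = 0 \<and> 0 \<le> u \<and> u \<le> b \<and> x = p - u \<and> y = q \<and> e = b \<and> n = b - 3 \<and> w = 0 \<and> s = 2) \<or>
     (h mod 4 = 1 \<and> 0 \<le> u \<and> u \<le> b - 1 \<and> x = p - u + 2 \<and> y = q \<and> e = b - 3 \<and> n = b \<and> w = 2 \<and> s = 0) \<or>
     (h mod 4 = 3 \<and> 2 \<le> u \<and> u \<le> b + 2 \<and> x = p - u + b + 2 \<and> y = q \<and> e = 0 \<and> n = 2 \<and> w = b \<and> s = b - 3) \<or>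
     (h mod 4 = 2 \<and> 3 \<le> u \<and> u \<le> b + 2 \<and> x = p - u + b \<and> y = q \<and> e = 2 \<and> n = 0 \<and> w = b - 3 \<and> s = b) \<or>
     ((u + h) mod 4 = 0 \<and> 3 - b \<le> u \<and> u \<le> 2 \<and> u \<noteq> 0 \<and> x = p \<and> y = q + u \<and> e = b \<and> n = b - 3 \<and> w = 0 \<and> s = 2) \<or>
     ((u + h) mod 4 = 3 \<and> 2 - b \<le> u \<and> u \<le> 1 \<and> x = p \<and> y = q + u - 2 \<and> e = b - 3 \<and> n = b \<and> w = 2 \<and> s = 0) \<or>
     ((u + h - b) mod 4 = 1 \<and> b \<le> u \<and> u \<le> 2 * b - 1 \<and> u \<noteq> b + 2 \<and> x = p \<and> y = q + u - b - 2 \<and> e = 0 \<and> n = 2 \<and> w = b \<and> s = b - 3) \<or>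
     ((u + h - b) mod 4 = 2 \<and> b < u \<and> u \<le> 2 * b \<and> x = p \<and> y = q + u - b \<and> e = 2 \<and> n = 0 \<and> w = b - 3 \<and> s = b)"

lemma quad_at_of_quad:
  assumes quad: "quad b i m x y e n w s" and pq: "(p, q) \<in> cells x y e n w s" and b: "5 \<le> b"
  shows "quad_at b (p - q + 2 * m) (q - m) p q x y e n w s"
proof -
  have pm: "p - q + 2 * m + (q - m) = p + m" by simp
  from quad show ?thesis
    unfolding quad_def
  proof (elim disjE)
    assume *: "x = 4 * i - m \<and> y = 4 * i + m \<and> e = b \<and> n = b - 3 \<and> w = 0 \<and> s = 2"
    show ?thesis
    proof (cases "q = y")
      case True
      then have "(q - m) mod 4 = 0" by (intro mod_eqI[of _ _ i]) (use * in simp_all)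
      then show ?thesis using pq * True b unfolding quad_at_def mem_cells by (smt (verit))
    next
      case False
      then have "p = x" using pq by simp
      then have "(p + m) mod 4 = 0" by (intro mod_eqI[of _ _ i]) (use * in simp_all)
      then show ?thesis using pq * False \<open>p = x\<close> b unfolding quad_at_def mem_cells pm by (smt (verit))
    qed
  next
    assume *: "x = 4 * i - m + 3 \<and> y = 4 * i + m + 1 \<and> e = b - 3 \<and> n = b \<and> w = 2 \<and> s = 0"
    show ?thesis
    proof (cases "q = y")
      case True
      then have "(q - m) mod 4 = 1" by (intro mod_eqI[of _ _ i]) (use * in simp_all)
      then show ?thesis using pq * True b unfolding quad_at_def mem_cells by (smt (verit))
    next
      case False
      then have "p = x" using pq by simp
      then have "(p + m) mod 4 = 3" by (intro mod_eqI[of _ _ i]) (use * in simp_all)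
      then show ?thesis using pq * False \<open>p = x\<close> b unfolding quad_at_def mem_cells pm by (smt (verit))
    qed
  next
    assume *: "x = 4 * i - m + b + 1 \<and> y = 4 * i + m - 1 \<and> e = 0 \<and> n = 2 \<and> w = b \<and> s = b - 3"
    show ?thesis
    proof (cases "q = y")
      case True
      then have "(q - m) mod 4 = 3" by (intro mod_eqI[of _ _ "i - 1"]) (use * in simp_all)
      then show ?thesis using pq * True b unfolding quad_at_def mem_cells by (smt (verit))
    next
      case False
      then have "p = x" using pq by simp
      then have "(p + m - b) mod 4 = 1" by (intro mod_eqI[of _ _ i]) (use * in simp_all)
      then show ?thesis using pq * False \<open>p = x\<close> b unfolding quad_at_def mem_cells pm by (smt (verit))
    qed
  next
    assume *: "x = 4 * i - m + b - 2 \<and> y = 4 * i + m - 2 \<and> e = 2 \<and> n = 0 \<and> w = b - 3 \<and> s = b"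
    show ?thesis
    proof (cases "q = y")
      case True
      then have "(q - m) mod 4 = 2" by (intro mod_eqI[of _ _ "i - 1"]) (use * in simp_all)
      then show ?thesis using pq * True b unfolding quad_at_def mem_cells by (smt (verit))
    next
      case False
      then have "p = x" using pq by simp
      then have "(p + m - b) mod 4 = 2" by (intro mod_eqI[of _ _ "i - 1"]) (use * in simp_all)
      then show ?thesis using pq * False \<open>p = x\<close> b unfolding quad_at_def mem_cells pm by (smt (verit))
    qed
  qed
qed

lemma quad_of_quad_at:
  assumes at: "quad_at b (p - q + 2 * m) (q - m) p q x y e n w s" and b: "5 \<le> b"
  shows "\<exists>i. quad b i m x y e n w s \<and> (p, q) \<in> cells x y e n w s"
proof -
  have 4: "\<exists>i. v = 4 * i + r" if "v mod 4 = r" for v r :: int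
    using that by (metis mult_div_mod_eq)
  have pm: "p - q + 2 * m + (q - m) = p + m" "p - q + 2 * m + (q - m) - b = p + m - b" by simp_all
  from at show ?thesis
    unfolding quad_at_def pm
  proof (elim disjE conjE)
    assume *: "(q - m) mod 4 = 0"
    obtain i where i: "q - m = 4 * i + 0" using 4[OF *] by blast
    show ?thesis if "0 \<le> p - q + 2 * m" "p - q + 2 * m \<le> b" "x = p - (p - q + 2 * m)" "y = q" "e = b" "n = b - 3" "w = 0" "s = 2"
      using that b i unfolding quad_def by (intro exI[of _ i]) auto
  next
    assume *: "(q - m) mod 4 = 1"
    obtain i where i: "q - m = 4 * i + 1" using 4[OF *] by blast
    show ?thesis if "0 \<le> p - q + 2 * m" "p - q + 2 * m \<le> b - 1" "x = p - (p - q + 2 * m) + 2" "y = q" "e = b - 3" "n = b" "w = 2" "s = 0"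
      using that b i unfolding quad_def by (intro exI[of _ i]) auto
  next
    assume *: "(q - m) mod 4 = 3"
    obtain i where i: "q - m = 4 * i + 3" using 4[OF *] by blast
    show ?thesis if "2 \<le> p - q + 2 * m" "p - q + 2 * m \<le> b + 2" "x = p - (p - q + 2 * m) + b + 2" "y = q" "e = 0" "n = 2" "w = b" "s = b - 3"
      using that b i unfolding quad_def by (intro exI[of _ "i + 1"]) auto
  next
    assume *: "(q - m) mod 4 = 2"
    obtain i where i: "q - m = 4 * i + 2" using 4[OF *] by blast
    show ?thesis if "3 \<le> p - q + 2 * m" "p - q + 2 * m \<le> b + 2" "x = p - (p - q + 2 * m) + b" "y = q" "e = 2" "n = 0" "w = b - 3" "s = b"
      using that b i unfolding quad_def by (intro exI[of _ "i + 1"]) auto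
  next
    assume *: "(p + m) mod 4 = 0"
    obtain i where i: "p + m = 4 * i + 0" using 4[OF *] by blast
    show ?thesis if "3 - b \<le> p - q + 2 * m" "p - q + 2 * m \<le> 2" "x = p" "y = q + (p - q + 2 * m)" "e = b" "n = b - 3" "w = 0" "s = 2"
      using that b i unfolding quad_def by (intro exI[of _ i]) auto
  next
    assume *: "(p + m) mod 4 = 3"
    obtain i where i: "p + m = 4 * i + 3" using 4[OF *] by blast
    show ?thesis if "2 - b \<le> p - q + 2 * m" "p - q + 2 * m \<le> 1" "x = p" "y = q + (p - q + 2 * m) - 2" "e = b - 3" "n = b" "w = 2" "s = 0"
      using that b i unfolding quad_def by (intro exI[of _ i]) auto
  next
    assume *: "(p + m - b) mod 4 = 1"
    obtain i where i: "p + m - b = 4 * i + 1" using 4[OF *] by blast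
    show ?thesis if "b \<le> p - q + 2 * m" "p - q + 2 * m \<le> 2 * b - 1" "x = p" "y = q + (p - q + 2 * m) - b - 2" "e = 0" "n = 2" "w = b" "s = b - 3"
      using that b i unfolding quad_def by (intro exI[of _ i]) auto
  next
    assume *: "(p + m - b) mod 4 = 2"
    obtain i where i: "p + m - b = 4 * i + 2" using 4[OF *] by blast
    show ?thesis if "b < p - q + 2 * m" "p - q + 2 * m \<le> 2 * b" "x = p" "y = q + (p - q + 2 * m) - b" "e = 2" "n = 0" "w = b - 3" "s = b"
      using that b i unfolding quad_def by (intro exI[of _ "i + 1"]) auto
  qed
qed

text \<open>These values span less than \<open>4 * b\<close>, while raising \<open>m\<close> by
  \<open>b\<close> adds \<open>2 * b\<close>; so tiles containing a given cell belong to equal or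
  consecutive multiples.\<close>

lemma quad_range:
  assumes "quad b i m x y e n w s" "(p, q) \<in> cells x y e n w s" "5 \<le> b"
  shows "2 - b \<le> p - q + 2 * m" "p - q + 2 * m \<le> 2 * b"
  using assms unfolding quad_def mem_cells by (smt (verit))+

lemma quad_at_unique:
  assumes "quad_at b u h p q x y e n w s" "quad_at b u h p q x' y' e' n' w' s'" "5 \<le> b"
  shows "x = x' \<and> y = y' \<and> e = e' \<and> n = n' \<and> w = w' \<and> s = s'"
proof -
  define k where "k = h div 4"
  have "0 \<le> h mod 4" "h mod 4 < 4" "h = 4 * k + h mod 4" unfolding k_def by simp_all
  then have h: "h = 4 * k \<or> h = 4 * k + 1 \<or> h = 4 * k + 2 \<or> h = 4 * k + 3" by linarith
  have "u < 0 \<or> u = 0 \<or> u = 1 \<or> u = 2 \<or> 3 \<le> u \<and> u < b \<or> u = b \<or> u = b + 1 \<or> u = b + 2 \<or> b + 2 < u"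
    by linarith
  with h show ?thesis
    by (elim disjE) (use assms in \<open>auto simp: quad_at_def\<close>)
qed

text \<open>The pairs \<open>(u, h)\<close> and \<open>(u + 2 * b, h - b)\<close> describe one cell
  with respect to \<open>m\<close> and \<open>m + b\<close>: consecutive diagonal bands do not
  overlap.\<close>

lemma quad_at_shift:
  assumes "quad_at b u h p q x y e n w s" "quad_at b (u + 2 * b) (h - b) p q x' y' e' n' w' s'" "5 \<le> b"
  shows False
proof -
  define k where "k = (h - b) div 4"
  have "0 \<le> (h - b) mod 4" "(h - b) mod 4 < 4" "h - b = 4 * k + (h - b) mod 4" unfolding k_def by simp_all
  then have h: "h = b + 4 * k \<or> h = b + (4 * k + 1) \<or> h = b + (4 * k + 2) \<or> h = b + (4 * k + 3)" by linarith
  have eqs: "u + 2 * b + (h - b) - b = u + h" by simp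
  consider "u < 2 - b" | "u = 2 - b" | "2 - b < u" "u < 0" | "u = 0" | "0 < u" by linarith
  then show False
  proof cases
    case 2
    with h show ?thesis
      by (elim disjE) (use assms in \<open>auto simp: quad_at_def eqs\<close>)
  qed (use assms in \<open>auto simp: quad_at_def eqs\<close>)
qed

lemma quad_at_cases:
  assumes "5 \<le> b" "0 \<le> u" "u < 2 * b"
  shows "(\<exists>x y e n w s. quad_at b u h p q x y e n w s) \<or>
    (\<exists>x y e n w s. quad_at b (u - 2 * b) (h + b) p q x y e n w s) \<or>
    (\<exists>x y e n w s. quad_at b (u + 2 * b) (h - b) p q x y e n w s)"
proof -
  define k where "k = h div 4"
  have "0 \<le> h mod 4" "h mod 4 < 4" "h = 4 * k + h mod 4" unfolding k_def by simp_all
  then have h: "h = 4 * k \<or> h = 4 * k + 1 \<or> h = 4 * k + 2 \<or> h = 4 * k + 3" by linarith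
  have r: "0 \<le> (u + h - b) mod 4" "(u + h - b) mod 4 < 4" by simp_all
  have eqs: "u - 2 * b + (h + b) = u + h - b" "u + 2 * b + (h - b) - b = u + h" by simp_all
  consider "u = 0" | "u = 1" | "u = 2" | "3 \<le> u" "u < b" | "u = b" | "u = b + 1" | "u = b + 2"
    | "b + 2 < u" using assms by linarith
  then show ?thesis
  proof cases
    case 8
    then show ?thesis
      using r assms unfolding quad_at_def eqs ex_disj_distrib by simp linarith
  qed (use h assms in \<open>auto simp: quad_at_def eqs ex_disj_distrib\<close>)
qed

lemma tiles_t_2_plus_3:
  assumes "2 \<le> a"
  shows "tiles (cross a (a + 3) 2 0) plane"
proof -
  define b where "b = int a + 3"
  have b: "5 \<le> b" unfolding b_def using assms by simp
  define S where "S x y e n w s \<longleftrightarrow> (\<exists>i j. quad b i (b * j) x y e n w s)" for x y e n w s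
  show ?thesis
  proof (rule tiles_planeI[where S = S])
    fix x y e n w s
    assume "S x y e n w s"
    then show "arms (int a) (int (a + 3)) (int 2) (int 0) e n w s"
      unfolding S_def quad_def arms_def b_def by auto
  next
    fix p q
    define j where "j = - ((p - q) div (2 * b))"
    define u where "u = p - q + 2 * (b * j)"
    define h where "h = q - b * j"
    have "u = (p - q) mod (2 * b)"
      unfolding u_def j_def by (simp add: algebra_simps minus_div_mult_eq_mod[symmetric])
    then have u: "0 \<le> u" "u < 2 * b" using b by simp_all
    have covered: "\<exists>x y e n w s. S x y e n w s \<and> (p, q) \<in> cells x y e n w s"
      if "quad_at b (p - q + 2 * (b * j')) (q - b * j') p q x y e n w s" for j' x y e n w s
      using quad_of_quad_at[OF that b] unfolding S_def by blast
    have eqs: "p - q + 2 * (b * (j - 1)) = u - 2 * b" "q - b * (j - 1) = h + b"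
      "p - q + 2 * (b * (j + 1)) = u + 2 * b" "q - b * (j + 1) = h - b"
      unfolding u_def h_def by (simp_all add: algebra_simps)
    from quad_at_cases[OF b u, of h p q]
    show "\<exists>x y e n w s. S x y e n w s \<and> (p, q) \<in> cells x y e n w s"
    proof (elim disjE exE)
      fix x y e n w s assume "quad_at b u h p q x y e n w s"
      then show ?thesis unfolding u_def h_def by (rule covered)
    next
      fix x y e n w s assume "quad_at b (u - 2 * b) (h + b) p q x y e n w s"
      then show ?thesis unfolding eqs[symmetric] by (rule covered)
    next
      fix x y e n w s assume "quad_at b (u + 2 * b) (h - b) p q x y e n w s"
      then show ?thesis unfolding eqs[symmetric] by (rule covered)
    qed
  next
    fix x y e n w s x' y' e' n' w' s' p q
    assume "S x y e n w s" "S x' y' e' n' w' s'"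
      and pq: "(p, q) \<in> cells x y e n w s" "(p, q) \<in> cells x' y' e' n' w' s'"
    then obtain i j i' j' where t: "quad b i (b * j) x y e n w s" "quad b i' (b * j') x' y' e' n' w' s'"
      unfolding S_def by blast
    note at = quad_at_of_quad[OF t(1) pq(1) b] quad_at_of_quad[OF t(2) pq(2) b]
    consider "j' = j" | "j' = j + 1" | "j = j' + 1" | "j + 2 \<le> j'" | "j' + 2 \<le> j" by linarith
    then show "x = x' \<and> y = y' \<and> e = e' \<and> n = n' \<and> w = w' \<and> s = s'"
    proof cases
      case 1
      then show ?thesis using quad_at_unique at b by metis
    next
      case 2
      then have "p - q + 2 * (b * j') = p - q + 2 * (b * j) + 2 * b" "q - b * j' = q - b * j - b"
        by (simp_all add: algebra_simps)
      then show ?thesis using quad_at_shift[OF at(1)] at(2) b by metis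
    next
      case 3
      then have "p - q + 2 * (b * j) = p - q + 2 * (b * j') + 2 * b" "q - b * j = q - b * j' - b"
        by (simp_all add: algebra_simps)
      then show ?thesis using quad_at_shift[OF at(2)] at(1) b by metis
    next
      case 4
      then have "b * (j + 2) \<le> b * j'" using b by (intro mult_left_mono) auto
      then show ?thesis
        using quad_range[OF t(1) pq(1) b] quad_range[OF t(2) pq(2) b] b by (simp add: algebra_simps)
    next
      case 5
      then have "b * (j' + 2) \<le> b * j" using b by (intro mult_left_mono) auto
      then show ?thesis
        using quad_range[OF t(1) pq(1) b] quad_range[OF t(2) pq(2) b] b by (simp add: algebra_simps)
    qed
  qed
qed

section \<open>Corners and edges\<close>

lemma tiles_cells:
  assumes "tiles (cross a b c d) \<Omega>" "(p, q) \<in> \<Omega>"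
  obtains x y e n w s where "arms (int a) (int b) (int c) (int d) e n w s"
    "cells x y e n w s \<subseteq> \<Omega>" "(p, q) \<in> cells x y e n w s"
proof -
  obtain C where C: "is_copy (cross a b c d) C" "C \<subseteq> \<Omega>" "(p, q) \<in> C"
    using assms unfolding tiles_def by blast
  obtain x y e n w s where "arms (int a) (int b) (int c) (int d) e n w s" "C = cells x y e n w s"
    using C(1) unfolding is_copy_iff by (elim exE conjE)
  with C show thesis using that by simp
qed

lemma arms_pos:
  assumes "arms (int a) (int b) (int c) (int d) e n w s" "1 \<le> a" "1 \<le> b" "1 \<le> c" "1 \<le> d"
  shows "1 \<le> e" "1 \<le> n" "1 \<le> w" "1 \<le> s"
  using assms unfolding arms_def by (elim disjE; simp)+

lemma arms_le:
  assumes "arms (int a) (int b) (int c) (int d) e n w s"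
    "int a \<le> M" "int b \<le> M" "int c \<le> M" "int d \<le> M"
  shows "e \<le> M" "n \<le> M" "w \<le> M" "s \<le> M"
  using assms unfolding arms_def by (elim disjE; simp)+

text \<open>Positive left and lower arms inside the quadrant keep the centre off both axes, so
  neither bar reaches the origin.\<close>

lemma cross_not_tiles_corner:
  assumes pos: "1 \<le> a" "1 \<le> b" "1 \<le> c" "1 \<le> d"
    and \<Omega>: "(0, 0) \<in> \<Omega>" "\<Omega> \<subseteq> {0..} \<times> {0..}"
  shows "\<not> tiles (cross a b c d) \<Omega>"
proof
  assume "tiles (cross a b c d) \<Omega>"
  then obtain x y e n w s where t: "arms (int a) (int b) (int c) (int d) e n w s"
    "cells x y e n w s \<subseteq> \<Omega>" "(0, 0) \<in> cells x y e n w s"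
    using \<Omega>(1) by (rule tiles_cells)
  note p = arms_pos[OF t(1) pos]
  have "(x - w, y) \<in> cells x y e n w s" "(x, y - s) \<in> cells x y e n w s"
    using p by simp_all
  then have "0 \<le> x - w" "0 \<le> y - s"
    using t(2) \<Omega>(2) by blast+
  then show False
    using t(3) p by simp
qed

text \<open>A cell on the edge can only be the end of a lower arm. Of two such arms side by side,
  the side arm at the lower centre, or at either one for equal heights, hits the other tile.\<close>

lemma cross_not_tiles_edge:
  assumes pos: "1 \<le> a" "1 \<le> b" "1 \<le> c" "1 \<le> d"
    and \<Omega>: "(0, 0) \<in> \<Omega>" "(1, 0) \<in> \<Omega>" "\<Omega> \<subseteq> UNIV \<times> {0..}"
  shows "\<not> tiles (cross a b c d) \<Omega>"
proof
  assume "tiles (cross a b c d) \<Omega>"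
  then obtain T where T: "\<And>C. C \<in> T \<Longrightarrow> is_copy (cross a b c d) C \<and> C \<subseteq> \<Omega>" "pairwise disjnt T" "\<Union> T = \<Omega>"
    unfolding tiles_def by blast
  have foot: "\<exists>y e n w. 1 \<le> y \<and> 1 \<le> e \<and> 1 \<le> w \<and> 1 \<le> n \<and> C = cells p y e n w y"
    if C: "C \<in> T" "(p, 0) \<in> C" for C p
  proof -
    obtain x y e n w s where t: "arms (int a) (int b) (int c) (int d) e n w s" "C = cells x y e n w s"
      using T(1)[OF C(1)] unfolding is_copy_iff by (elim exE conjE)
    note p = arms_pos[OF t(1) pos]
    have "(x, y - s) \<in> C" using p t(2) by simp
    then have "0 \<le> y - s"
      using T(1)[OF C(1)] \<Omega>(3) by blast
    then have "p = x" "y = s"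
      using C(2) p unfolding t(2) by simp_all
    then show ?thesis using p t(2) by blast
  qed
  obtain C D where C: "C \<in> T" "(0, 0) \<in> C" and D: "D \<in> T" "(1, 0) \<in> D"
    using \<Omega> T(3) by blast
  obtain y e n w where c: "1 \<le> y" "1 \<le> e" "1 \<le> w" "1 \<le> n" "C = cells 0 y e n w y"
    using foot[OF C] by blast
  obtain y' e' n' w' where d: "1 \<le> y'" "1 \<le> e'" "1 \<le> w'" "1 \<le> n'" "D = cells 1 y' e' n' w' y'"
    using foot[OF D] by blast
  have "(1, 0) \<notin> C" using c by simp
  then have "disjnt C D"
    using pairwiseD[OF T(2) C(1) D(1)] D(2) by blast
  moreover have "(1, y) \<in> C \<and> (1, y) \<in> D \<or> (0, y') \<in> C \<and> (0, y') \<in> D"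
    using c d by auto
  ultimately show False
    unfolding disjnt_iff by blast
qed

section \<open>Enlargements\<close>

lemma mem_enlargement:
  assumes k: "1 \<le> k"
  shows "(p, q) \<in> enlargement k (cross a b c d) \<longleftrightarrow>
    0 \<le> q \<and> q \<le> k - 1 \<and> - (k * int c) \<le> p \<and> p \<le> k * int a + k - 1 \<or>
    0 \<le> p \<and> p \<le> k - 1 \<and> - (k * int d) \<le> q \<and> q \<le> k * int b + k - 1"
proof -
  have block: "k * x \<le> r \<and> r \<le> k * x + k - 1 \<longleftrightarrow> r div k = x" for x r
  proof
    assume "k * x \<le> r \<and> r \<le> k * x + k - 1"
    then show "r div k = x"
      using k by (intro int_div_pos_eq[of r k x "r - k * x"]) auto
  next
    assume "r div k = x"
    then have "k * x + r mod k = r"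
      using mult_div_mod_eq[of k r] by simp
    moreover have "0 \<le> r mod k" "r mod k < k"
      using k by simp_all
    ultimately show "k * x \<le> r \<and> r \<le> k * x + k - 1"
      by linarith
  qed
  have range: "- int m \<le> r div k \<and> r div k \<le> int l \<longleftrightarrow> - (k * int m) \<le> r \<and> r \<le> k * int l + k - 1" for r m l
  proof -
    define D where "D = r div k"
    have D: "k * D \<le> r" "r \<le> k * D + k - 1"
      using block[of D r] unfolding D_def by simp_all
    have mono: "k * u \<le> k * v" if "u \<le> v" for u v
      using that k by simp
    have "- int m \<le> D \<Longrightarrow> - (k * int m) \<le> k * D" "D \<le> - int m - 1 \<Longrightarrow> k * D \<le> - (k * int m) - k"
      using mono[of "- int m" D] mono[of D "- int m - 1"] by (simp_all add: right_diff_distrib)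
    then have "- int m \<le> D \<longleftrightarrow> - (k * int m) \<le> r"
      using D k by linarith
    moreover have "D \<le> int l \<Longrightarrow> k * D \<le> k * int l" "int l + 1 \<le> D \<Longrightarrow> k * int l + k \<le> k * D"
      using mono[of D "int l"] mono[of "int l + 1" D] by (simp_all add: distrib_left)
    then have "D \<le> int l \<longleftrightarrow> r \<le> k * int l + k - 1"
      using D k by linarith
    ultimately show ?thesis unfolding D_def by simp
  qed
  have "(p, q) \<in> enlargement k (cross a b c d) \<longleftrightarrow> (\<exists>x y. (x, y) \<in> cross a b c d \<and>
      (k * x \<le> p \<and> p \<le> k * x + k - 1) \<and> (k * y \<le> q \<and> q \<le> k * y + k - 1))"
    by (simp add: enlargement_def Bex_def)
  also have "\<dots> \<longleftrightarrow> (p div k, q div k) \<in> cross a b c d"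
    unfolding block by simp
  also have "\<dots> \<longleftrightarrow> q div k = 0 \<and> - int c \<le> p div k \<and> p div k \<le> int a \<or>
      p div k = 0 \<and> - int d \<le> q div k \<and> q div k \<le> int b"
    by (simp add: mem_cross)
  finally show ?thesis
    unfolding range using block[of 0 p] block[of 0 q] by auto
qed

text \<open>A centre needs all four neighbours in the region. Hence a tile over an outer corner cell
  at the end of the magnified longest arm would be centred in the columns (or rows) of the central
  block, at distance at least \<open>2 * M\<close>, though its arms have length at most
  \<open>M\<close>.\<close>

lemma cross_not_tiles_enlargement:
  assumes pos: "1 \<le> a" "1 \<le> b" "1 \<le> c" "1 \<le> d" and k: "2 \<le> k"
  shows "\<not> tiles (cross a b c d) (enlargement k (cross a b c d))" (is "\<not> tiles _ ?E")
proof
  assume tiles: "tiles (cross a b c d) ?E"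
  define M where "M = max (max (int a) (int b)) (max (int c) (int d))"
  have M: "int a \<le> M" "int b \<le> M" "int c \<le> M" "int d \<le> M"
    "M = int a \<or> M = int b \<or> M = int c \<or> M = int d"
    unfolding M_def by (auto simp: max_def)
  have big: "2 * int l \<le> k * int l" for l using k by (simp add: mult_right_mono)
  define A B C D where ABCD: "A = k * int a" "B = k * int b" "C = k * int c" "D = k * int d"
  have nn: "2 \<le> A" "2 \<le> B" "2 \<le> C" "2 \<le> D"
    using big[of a] big[of b] big[of c] big[of d] pos unfolding ABCD by linarith+
  have mem: "(p, q) \<in> ?E \<longleftrightarrow> 0 \<le> q \<and> q \<le> k - 1 \<and> - C \<le> p \<and> p \<le> A + k - 1 \<or>
      0 \<le> p \<and> p \<le> k - 1 \<and> - D \<le> q \<and> q \<le> B + k - 1" for p q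
    using mem_enlargement[of k p q a b c d] k unfolding ABCD by simp
  have "1 \<le> M" using M pos by linarith
  have E: "\<exists>x y e n w s. 1 \<le> e \<and> 1 \<le> n \<and> 1 \<le> w \<and> 1 \<le> s \<and> e \<le> M \<and> n \<le> M \<and> w \<le> M \<and> s \<le> M \<and>
      (p, q) \<in> cells x y e n w s \<and> (x + 1, y) \<in> ?E \<and> (x - 1, y) \<in> ?E \<and> (x, y + 1) \<in> ?E \<and> (x, y - 1) \<in> ?E"
    if pq: "(p, q) \<in> ?E" for p q
  proof -
    obtain x y e n w s where t: "arms (int a) (int b) (int c) (int d) e n w s"
      "cells x y e n w s \<subseteq> ?E" "(p, q) \<in> cells x y e n w s"
      by (rule tiles_cells[OF tiles pq])
    note r = arms_pos[OF t(1) pos] arms_le[OF t(1) M(1-4)]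
    have "{(x + 1, y), (x - 1, y), (x, y + 1), (x, y - 1)} \<subseteq> cells x y e n w s"
      using r by simp
    with t(2) have "{(x + 1, y), (x - 1, y), (x, y + 1), (x, y - 1)} \<subseteq> ?E" by (rule order_trans[rotated])
    with r t(3) show ?thesis by (simp only: insert_subset) blast
  qed
  consider "2 * M \<le> A" | "2 * M \<le> B" | "2 * M \<le> C" | "2 * M \<le> D"
    using M(5) big[of a] big[of b] big[of c] big[of d] unfolding ABCD by metis
  then show False
  proof cases
    case 1
    have "(A + k - 1, k - 1) \<in> ?E" using nn k unfolding mem by simp
    from E[OF this] show False
      unfolding mem mem_cells using 1 nn k \<open>1 \<le> M\<close> by (elim exE conjE) (smt (verit))
  next
    case 2
    have "(k - 1, B + k - 1) \<in> ?E" using nn k unfolding mem by simp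
    from E[OF this] show False
      unfolding mem mem_cells using 2 nn k \<open>1 \<le> M\<close> by (elim exE conjE) (smt (verit))
  next
    case 3
    have "(- C, k - 1) \<in> ?E" using nn k unfolding mem by simp
    from E[OF this] show False
      unfolding mem mem_cells using 3 nn k \<open>1 \<le> M\<close> by (elim exE conjE) (smt (verit))
  next
    case 4
    have "(k - 1, - D) \<in> ?E" using nn k unfolding mem by simp
    from E[OF this] show False
      unfolding mem mem_cells using 4 nn k \<open>1 \<le> M\<close> by (elim exE conjE) (smt (verit))
  qed
qed

section \<open>Connectedness and assembly of the result\<close>

lemma polyomino_cross: "polyomino (cross a b c d)"
proof -
  let ?R = "{(r, s). r \<in> cross a b c d \<and> s \<in> cross a b c d \<and> adjacent r s}"
  have arm: "((0, 0), (u * int i, v * int i)) \<in> ?R\<^sup>*"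
    if "\<And>i. i \<le> l \<Longrightarrow> (u * int i, v * int i) \<in> cross a b c d" "\<bar>u\<bar> + \<bar>v\<bar> = 1" "i \<le> l" for u v :: int and i l
    using that(3)
  proof (induction i)
    case (Suc i)
    have "adjacent (u * int i, v * int i) (u * int (Suc i), v * int (Suc i))"
      using that(2) unfolding adjacent_def by (simp add: algebra_simps)
    then have "((u * int i, v * int i), (u * int (Suc i), v * int (Suc i))) \<in> ?R"
      using that(1)[of i] that(1)[of "Suc i"] Suc.prems by simp
    with Suc.IH Suc.prems show ?case
      by (meson Suc_leD rtrancl.rtrancl_into_rtrancl)
  qed simp
  have reach: "((0, 0), p) \<in> ?R\<^sup>*" if mem: "p \<in> cross a b c d" for p
  proof -
    obtain x y where p: "p = (x, y)" by fastforce
    consider "y = 0" "0 \<le> x" "x \<le> int a" | "y = 0" "x < 0" "- int c \<le> x"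
      | "x = 0" "0 \<le> y" "y \<le> int b" | "x = 0" "y < 0" "- int d \<le> y"
      using mem unfolding p mem_cross mem_cells by linarith
    then show ?thesis
    proof cases
      case 1
      then show ?thesis using arm[of a 1 0 "nat x"] unfolding p by (simp add: mem_cross)
    next
      case 2
      then show ?thesis using arm[of c "- 1" 0 "nat (- x)"] unfolding p by (simp add: mem_cross)
    next
      case 3
      then show ?thesis using arm[of b 0 1 "nat y"] unfolding p by (simp add: mem_cross)
    next
      case 4
      then show ?thesis using arm[of d 0 "- 1" "nat (- y)"] unfolding p by (simp add: mem_cross)
    qed
  qed
  have "sym ?R" unfolding sym_def adjacent_def by (auto simp: abs_minus_commute)
  then have "sym (?R\<^sup>*)" by (rule sym_rtrancl)
  then have path: "(p, q) \<in> ?R\<^sup>*" if "p \<in> cross a b c d" "q \<in> cross a b c d" for p q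
    using reach[OF that(1)] reach[OF that(2)] by (meson rtrancl_trans symD)
  have "cross a b c d = cells 0 0 (int a) (int b) (int c) (int d)"
    using mem_cross by auto
  then have "finite (cross a b c d)"
    unfolding cells_def by simp
  moreover have "(0, 0) \<in> cross a b c d" by (simp add: mem_cross)
  ultimately show ?thesis
    unfolding polyomino_def using path by blast
qed

lemma non_tiler_cross:
  assumes "1 < a" "1 < b" "1 < c" "1 < d"
  shows "non_tiler (cross a b c d)"
proof -
  have pos: "1 \<le> a" "1 \<le> b" "1 \<le> c" "1 \<le> d" using assms by simp_all
  note corner = cross_not_tiles_corner[OF pos] and edge = cross_not_tiles_edge[OF pos]
  show ?thesis
    unfolding non_tiler_def
  proof (intro conjI allI impI)
    show "polyomino (cross a b c d)" by (rule polyomino_cross)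
    show "\<not> tiles (cross a b c d) plane"
      using assms by (intro cross_not_tiles) auto
    show "\<not> tiles (cross a b c d) (enlargement k (cross a b c d))" if "2 \<le> k" for k
      by (rule cross_not_tiles_enlargement[OF pos that])
  qed (rule corner edge;
      auto simp: rectangle_def half_strip_def bent_strip_def quadrant_def strip_def half_plane_def)+
qed

text \<open>Reflection in the diagonal reduces the case \<open>b = d = 1\<close> to
  \<open>a = c = 1\<close>.\<close>

lemma tiles_cross_transpose: "tiles (cross b a d c) \<Omega> \<longleftrightarrow> tiles (cross a b c d) \<Omega>"
proof -
  have iff: "arms (int b) (int a) (int d) (int c) e n w s \<longleftrightarrow> arms (int a) (int b) (int c) (int d) e n w s"
    for e n w s
    unfolding arms_def by argo
  show ?thesis
    unfolding tiles_def is_copy_iff iff ..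
qed

theorem corollary2p3:
  "(\<forall>a b c :: nat. a \<ge> c \<and> c \<ge> 1 \<and> b \<ge> 1 \<longrightarrow>
      (tiles (cross a b c 0) plane \<longleftrightarrow> b \<le> 2 \<or> c = 1 \<or> (c = 2 \<and> b = a + 3))) \<and>
   (\<forall>a b c d :: nat. a \<ge> 1 \<and> b \<ge> 1 \<and> c \<ge> 1 \<and> d \<ge> 1 \<longrightarrow>
      (tiles (cross a b c d) plane \<longleftrightarrow> (a = 1 \<and> c = 1) \<or> (b = 1 \<and> d = 1))) \<and>
   (\<forall>a b c d :: nat. a > 1 \<and> b > 1 \<and> c > 1 \<and> d > 1 \<longrightarrow>
      \<not> tiles (cross a b c d) plane \<and> non_tiler (cross a b c d))"
proof (intro conjI allI impI)
  fix a b c :: nat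
  assume abc: "a \<ge> c \<and> c \<ge> 1 \<and> b \<ge> 1"
  show "tiles (cross a b c 0) plane \<longleftrightarrow> b \<le> 2 \<or> c = 1 \<or> (c = 2 \<and> b = a + 3)"
  proof
    assume "tiles (cross a b c 0) plane"
    then show "b \<le> 2 \<or> c = 1 \<or> (c = 2 \<and> b = a + 3)"
      using t_not_tiles[of c a b] abc by linarith
  next
    assume "b \<le> 2 \<or> c = 1 \<or> (c = 2 \<and> b = a + 3)"
    then consider "b = 1" | "b = 2" | "c = 1" | "c = 2" "b = a + 3"
      using abc by linarith
    then show "tiles (cross a b c 0) plane"
      by cases (use abc tiles_t_stem_1 tiles_t_stem_2 tiles_t_left_1 tiles_t_2_plus_3 in simp_all)
  qed
next
  fix a b c d :: nat
  assume pos: "a \<ge> 1 \<and> b \<ge> 1 \<and> c \<ge> 1 \<and> d \<ge> 1"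
  show "tiles (cross a b c d) plane \<longleftrightarrow> (a = 1 \<and> c = 1) \<or> (b = 1 \<and> d = 1)"
    using cross_not_tiles[of a b c d] pos tiles_cross_1_1[of b d] tiles_cross_1_1[of a c]
      tiles_cross_transpose[of 1 a 1 c plane] by auto
next
  fix a b c d :: nat
  assume big: "a > 1 \<and> b > 1 \<and> c > 1 \<and> d > 1"
  then show "non_tiler (cross a b c d)"
    by (intro non_tiler_cross) simp_all
  then show "\<not> tiles (cross a b c d) plane"
    unfolding non_tiler_def by blast
qed

end
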